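(* Let $0<\rho<\sigma/2$ and $S=[-\sigma,-\rho]\cup[\rho,\sigma]$. (i) There is a function $f\in PW_S^1$ such that $\|f\|_1=1$, $\Lambda(f_-)\cap\Lambda(f_+)=\emptyset$, at least one of the points $\sigma,-\sigma$ belongs to $\mathrm{Sp}(f)$, and $f\notin\mathrm{Ext}(PW_S^1)$. (ii) There is a function $f\in\mathrm{Ext}(PW_S^1)$ such that $\Omega(f_-)\cap\Omega(f_+)=\emptyset$, at least one of the points $\sigma,-\sigma$ belongs to $\mathrm{Sp}(f)$, $$\int_{\mathbb R}|f(x)|\,w(x)\,dx=\infty$$ for every nonconstant entire function $w$ with $\mathrm{Type}(w)=0$ and $w(x)\ge0$ for all $x\in\mathbb R$, and $f\notin\mathrm{Exp}(PW_S^1)$.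
   Context: Fourier transform: $\hat f(t)=\int_{\mathbb R}e^{-2\pi i tx}f(x)\,dx$. For $f\in L^1(\mathbb R)$ the spectrum is $\mathrm{Sp}(f)=\overline{\{t\in\mathbb R:\hat f(t)\neq 0\}}$ (extended to tempered distributions as the support of the distributional Fourier transform). For a closed set $S\subset\mathbb R$, $PW_S^1=\{f\in L^1(\mathbb R):\mathrm{Sp}(f)\subset S\}$, a complex Banach space with the $L^1$-norm $\|\cdot\|_1$. When $S$ is bounded, elements of $PW_S^1$ are identified with (restrictions to $\mathbb R$ of) entire functions of exponential type. For a Banach space $X$, $\mathrm{ball}(X)=\{f\in X:\|f\|\le1\}$. An element of $\mathrm{ball}(X)$ is extreme if it is not an interior point of any line segment contained in $\mathrm{ball}(X)$. An element $f\in\mathrm{ball}(X)$ is an exposed point if there is $\phi\in X^*$ with $\|\phi\|=1$ such that $\{g\in\mathrm{ball}(X):\phi(g)=1\}=\{f\}$. $\mathrm{Ext}(PW_S^1)$ and $\mathrm{Exp}(PW_S^1)$ are the sets of extreme and of exposed points of $\mathrm{ball}(PW_S^1)$. For $S=[-\sigma,-\rho]\cup[\rho,\sigma]$, every $f\in PW_S^1$ has a unique representation $f=f_-+f_+$ with $\mathrm{Sp}(f_-)\subset[-\sigma,-\rho]$ and $\mathrm{Sp}(f_+)\subset[\rho,\sigma]$; $f_\pm$ are entire functions. For an entire function $g$: $\Lambda(g)\subset\mathbb C\setminus\mathbb R$ is the set of all $\lambda\in\mathbb C\setminus\mathbb R$ with $g(\lambda)=g(\bar\lambda)=0$; $\Omega(g)\subset\mathbb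 R$ is the multiset of all $x\in\mathbb R$ at which $g$ has a zero of multiplicity at least $2$, where $x$ is counted with multiplicity $2n(x)$, $n(x)\ge1$ being the integer such that the multiplicity of the zero of $g$ at $x$ is $2n(x)$ or $2n(x)+1$. (If $g\equiv0$, every real point is regarded as belonging to $\Omega(g)$.) The condition $\Omega(f_-)\cap\Omega(f_+)=\emptyset$ means that no point belongs to both. An entire function $f$ has exponential type $d\ge0$, written $\mathrm{Type}(f)=d$, if for every $\varepsilon>0$ there is $C_\varepsilon$ with $|f(z)|\le C_\varepsilon e^{(d+\varepsilon)|z|}$ for all $z\in\mathbb C$, and $|f(z_n)|>e^{(d-\varepsilon)|z_n|}$ for some sequence $|z_n|\to\infty$. *)

theory Defs
  imports "HOL-Complex_Analysis.Complex_Analysis" "HOL-Library.Extended_Nat"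
begin

definition fourier :: "(real \<Rightarrow> complex) \<Rightarrow> real \<Rightarrow> complex" where
  "fourier f t = (LINT x|lborel. exp (- 2 * complex_of_real pi * \<i> * of_real t * of_real x) * f x)"

definition Sp :: "(real \<Rightarrow> complex) \<Rightarrow> real set" where
  "Sp f = closure {t. fourier f t \<noteq> 0}"

text \<open>
  The elements of \<open>L\<^sup>1\<close> are represented by integrable functions rather than by their
  almost-everywhere classes. Consequently equality of elements of \<open>PW1 S\<close> is expressed by
  \<open>eq_ae\<close> in all the definitions below.
\<close>

definition PW1 :: "real set \<Rightarrow> (real \<Rightarrow> complex) set" where
  "PW1 S = {f. integrable lborel f \<and> Sp f \<subseteq> S}"

definition eq_ae :: "(real \<Rightarrow> complex) \<Rightarrow> (real \<Rightarrow> complex) \<Rightarrow> bool" where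
  "eq_ae f g \<longleftrightarrow> (AE x in lborel. f x = g x)"

definition norm1 :: "(real \<Rightarrow> complex) \<Rightarrow> real" where
  "norm1 f = (LINT x|lborel. norm (f x))"

definition ball_PW1 :: "real set \<Rightarrow> (real \<Rightarrow> complex) set" where
  "ball_PW1 S = {f \<in> PW1 S. norm1 f \<le> 1}"

definition Ext_PW1 :: "real set \<Rightarrow> (real \<Rightarrow> complex) set" where
  "Ext_PW1 S = {f \<in> ball_PW1 S.
     \<not> (\<exists>g\<in>ball_PW1 S. \<exists>h\<in>ball_PW1 S. \<exists>t::real. \<not> eq_ae g h \<and> 0 < t \<and> t < 1 \<and>
          eq_ae f (\<lambda>x. (1 - t) *\<^sub>R g x + t *\<^sub>R h x))}"

text \<open>
  Complex-linear functionals on \<open>PW1 S\<close>, bounded for the \<open>L\<^sup>1\<close>-norm. Linearity and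
  boundedness force such a functional to take equal values on functions that agree almost everywhere;
  its values outside \<open>PW1 S\<close> are irrelevant.
\<close>

definition dual_PW1 :: "real set \<Rightarrow> ((real \<Rightarrow> complex) \<Rightarrow> complex) set" where
  "dual_PW1 S = {\<phi>.
     (\<forall>f\<in>PW1 S. \<forall>g\<in>PW1 S. \<phi> (\<lambda>x. f x + g x) = \<phi> f + \<phi> g) \<and>
     (\<forall>f\<in>PW1 S. \<forall>c. \<phi> (\<lambda>x. c * f x) = c * \<phi> f) \<and>
     (\<exists>C. \<forall>f\<in>PW1 S. norm (\<phi> f) \<le> C * norm1 f)}"

definition dual_norm :: "real set \<Rightarrow> ((real \<Rightarrow> complex) \<Rightarrow> complex) \<Rightarrow> real" where
  "dual_norm S \<phi> = (SUP f\<in>ball_PW1 S. norm (\<phi> f))"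

definition Exp_PW1 :: "real set \<Rightarrow> (real \<Rightarrow> complex) set" where
  "Exp_PW1 S = {f \<in> ball_PW1 S.
     \<exists>\<phi>\<in>dual_PW1 S. dual_norm S \<phi> = 1 \<and>
       {g \<in> ball_PW1 S. \<phi> g = 1} = {g \<in> ball_PW1 S. eq_ae g f}}"

text \<open>
  \<open>fm\<close> and \<open>fp\<close> are the entire functions whose restrictions to the real line
  are the components of \<open>f\<close> with spectrum in \<open>{- \<sigma>..- \<rho>}\<close> and
  \<open>{\<rho>..\<sigma>}\<close>. Both components of an integrable \<open>f\<close> are again integrable (a smooth
  cutoff on the Fourier side is convolution with a Schwartz function), and they are determined by
  \<open>f\<close> when \<open>0 < \<rho>\<close>.
\<close>

definition spectral_parts ::
    "real \<Rightarrow> real \<Rightarrow> (real \<Rightarrow> complex) \<Rightarrow> (complex \<Rightarrow> complex) \<Rightarrow> (complex \<Rightarrow> complex) \<Rightarrow> bool" where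
  "spectral_parts \<rho> \<sigma> f fm fp \<longleftrightarrow>
     fm holomorphic_on UNIV \<and> fp holomorphic_on UNIV \<and>
     (\<lambda>x. fm (of_real x)) \<in> PW1 {- \<sigma>..- \<rho>} \<and>
     (\<lambda>x. fp (of_real x)) \<in> PW1 {\<rho>..\<sigma>} \<and>
     eq_ae f (\<lambda>x. fm (of_real x) + fp (of_real x))"

definition Lambda :: "(complex \<Rightarrow> complex) \<Rightarrow> complex set" where
  "Lambda g = {l. l \<notin> \<real> \<and> g l = 0 \<and> g (cnj l) = 0}"

text \<open>
  The multiset \<open>\<Omega>(g)\<close> of an entire function \<open>g\<close> is given by its counting function
  on the real line: a zero of multiplicity \<open>m\<close> is counted \<open>2 * (m div 2)\<close> times. The
  function \<open>zorder\<close> is meaningful only if \<open>g\<close> does not vanish identically.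
\<close>

definition Omega_count :: "(complex \<Rightarrow> complex) \<Rightarrow> real \<Rightarrow> enat" where
  "Omega_count g x =
     (if \<forall>z. g z = 0 then \<infinity> else enat (2 * (nat (zorder g (of_real x)) div 2)))"

definition Omega_points :: "(complex \<Rightarrow> complex) \<Rightarrow> real set" where
  "Omega_points g = {x. Omega_count g x > 0}"

definition has_exp_type :: "(complex \<Rightarrow> complex) \<Rightarrow> real \<Rightarrow> bool" where
  "has_exp_type f d \<longleftrightarrow> f holomorphic_on UNIV \<and> 0 \<le> d \<and>
     (\<forall>\<epsilon>>0. (\<exists>C. \<forall>z. norm (f z) \<le> C * exp ((d + \<epsilon>) * norm z)) \<and>
       (\<exists>z :: nat \<Rightarrow> complex. filterlim (\<lambda>n. norm (z n)) at_top sequentially \<and>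
          (\<forall>n. norm (f (z n)) > exp ((d - \<epsilon>) * norm (z n)))))"

end

theory Submission
  imports Defs "HOL-Probability.Probability" "HOL-Real_Asymp.Real_Asymp"
begin

text \<open>
  Both examples come from one construction. Put \<open>\<theta> = 2 \<pi> a x\<close>, where \<open>a - d = \<rho>\<close> and
  \<open>2 a + d = \<sigma>\<close>; the hypothesis \<open>\<rho> < \<sigma> / 2\<close> says exactly that \<open>d > 0\<close>. Let \<open>\<psi>\<close> be the entire
  function whose Fourier transform is a sine arch on \<open>[0, d]\<close>, and put
  \<open>Q = 2 sin \<theta> \<psi>\<close> and \<open>F\<^sub>c = (c + cos \<theta>) Q = (2 c sin \<theta> + sin 2\<theta>) \<psi>\<close>. The spectrum of \<open>Q\<close> lies in
  \<open>\<plusminus>a + [0, d]\<close>. Multiplication by \<open>cos \<theta>\<close> shifts it by \<open>\<plusminus>a\<close>; the two pieces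
  that move to \<open>[0, d]\<close> cancel, and the others move to \<open>\<plusminus>2a + [0, d]\<close>. So \<open>Q\<close> and \<open>F\<^sub>c\<close> both
  have their spectrum in the two bands, \<open>F\<^sub>c\<close> reaches \<open>\<sigma>\<close>, and the real factor \<open>c + cos \<theta>\<close> mixes the two bands: it divides
  \<open>F\<^sub>c\<close>, but it divides neither of the components
  \<open>e\<^sup>i\<^sup>\<theta> (2 c + e\<^sup>i\<^sup>\<theta>) \<psi> / 2i\<close> and \<open>- e\<^sup>-\<^sup>i\<^sup>\<theta> (2 c + e\<^sup>-\<^sup>i\<^sup>\<theta>) \<psi> / 2i\<close>. The zeros of \<open>\<psi>\<close> are real and
  simple, and \<open>\<bar>e\<^sup>i\<^sup>\<theta>\<bar> = 2 c\<close> holds on one line off the real axis, so the first component has neither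
  conjugate pairs of zeros nor multiple real zeros.

  For \<open>c = 2\<close> the ratio \<open>Q / F\<^sub>c\<close> is real, bounded and not constant, hence \<open>F\<^sub>2\<close>, normalized, is the
  midpoint of a segment in the ball (\<open>not_Ext_if_ratio_bounded_below\<close>). For \<open>c = 1\<close> the ratio is
  nonnegative and unbounded. A functional of norm one that attains its norm at \<open>F\<^sub>1\<close> is determined by the
  derivative of the norm there, and therefore attains its norm at \<open>Q\<close> too, so \<open>F\<^sub>1\<close> is not exposed
  (\<open>not_Exp_if_ratio_nonneg\<close>).

  The function \<open>F\<^sub>1\<close> is nevertheless extreme. If \<open>f = F\<^sub>1 / \<parallel>F\<^sub>1\<parallel>\<close> is a convex combination, then its
  constituents are \<open>\<tau> f\<close> with \<open>\<tau>\<close> real and bounded. By Fourier inversion \<open>\<tau> f\<close> extends to an entire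
  function \<open>G\<close> with \<open>\<bar>G(z)\<bar> \<le> C e\<^bsup>2\<pi>\<sigma>\<bar>y\<bar>\<^esup>\<close>, where \<open>z = x + i y\<close>. In the lower half-plane \<open>F\<^sub>1\<close> has the
  same growth up to polynomial factors and a factor \<open>\<bar>y\<bar>\<^sup>4\<close> that accounts for its real zeros. Hence
  \<open>\<bar>\<tau>(z)\<bar> \<bar>y\<bar>\<^sup>4\<close> grows at most like a polynomial there, and by reflection in the upper half-plane as well.
  Such a bound makes an entire function a polynomial (\<open>higher_deriv_eq_0_if_bounded_off_line\<close>), and
  boundedness on the real line makes it constant (\<open>quotient_constant_if_real_bounded\<close>).

  Finally let \<open>w\<close> be of type zero with \<open>\<integral> \<bar>f\<bar> w < \<infinity>\<close>. Up to a factor of order \<open>1 / (1 + x\<^sup>2)\<close> the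
  function \<open>f\<close> is an exponential sum. The Borel transform of \<open>w\<close> has its only singularity at \<open>0\<close>, and
  multiplication of \<open>w\<close> by a normalized exponential sum adds translates of it, whose singularities are elsewhere.
  The Laplace integral therefore bounds the Borel transform near \<open>0\<close> by \<open>C / (Re s)\<^sup>2\<close>, and the same growth
  lemma shows that \<open>w\<close> is affine (\<open>affine_if_integrable_against_exp_sum\<close>). An affine function that is
  nonnegative on the real line is constant.
\<close>

section \<open>The Fourier transform on the real line\<close>

definition wave :: "real \<Rightarrow> real \<Rightarrow> complex" where
  "wave t x = exp (2 * complex_of_real pi * \<i> * of_real t * of_real x)"

lemma norm_wave [simp]: "norm (wave t x) = 1"
  by (simp add: wave_def norm_exp_eq_Re)

lemma wave_add_left: "wave (s + t) x = wave s x * wave t x"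
  by (simp add: wave_def ring_distribs exp_add)

lemma wave_measurable [measurable]:
  "(\<lambda>x. wave t x) \<in> borel_measurable borel" "(\<lambda>t. wave t x) \<in> borel_measurable borel"
  "(\<lambda>p. wave (fst p) (snd p)) \<in> borel_measurable (borel \<Otimes>\<^sub>M borel)"
  unfolding wave_def by measurable

lemma fourier_wave: "fourier f t = (LINT x|lborel. wave (- t) x * f x)"
  by (simp add: fourier_def wave_def)

lemma integrable_wave_mult [simp]:
  assumes "integrable lborel f" shows "integrable lborel (\<lambda>x. wave t x * f x)"
proof (rule Bochner_Integration.integrable_bound[OF assms])
  show "(\<lambda>x. wave t x * f x) \<in> borel_measurable lborel"
    using assms by measurable
qed (simp add: norm_mult)

lemma fourier_add:
  "integrable lborel f \<Longrightarrow> integrable lborel g \<Longrightarrow>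
    fourier (\<lambda>x. f x + g x) t = fourier f t + fourier g t"
  by (simp add: fourier_wave distrib_left)

lemma fourier_diff:
  "integrable lborel f \<Longrightarrow> integrable lborel g \<Longrightarrow>
    fourier (\<lambda>x. f x - g x) t = fourier f t - fourier g t"
  by (simp add: fourier_wave right_diff_distrib)

lemma fourier_cmult: "fourier (\<lambda>x. c * f x) t = c * fourier f t"
  by (simp add: fourier_wave mult.left_commute)

lemma fourier_wave_mult: "fourier (\<lambda>x. wave b x * f x) t = fourier f (t - b)"
proof -
  have "wave (- t) x * (wave b x * f x) = wave (- (t - b)) x * f x" for x
    by (simp add: mult.assoc[symmetric] wave_add_left[symmetric] add.commute)
  then show ?thesis by (simp only: fourier_wave)
qed

lemma fourier_cong_AE:
  assumes "integrable lborel f" "integrable lborel g" "eq_ae f g"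
  shows "fourier f = fourier g"
proof
  fix t
  have "AE x in lborel. wave (- t) x * f x = wave (- t) x * g x"
    using assms(3) by (auto simp: eq_ae_def elim!: AE_mp)
  then show "fourier f t = fourier g t"
    unfolding fourier_wave using assms by (intro integral_cong_AE) auto
qed

lemma norm_fourier_le:
  assumes "integrable lborel f" shows "norm (fourier f t) \<le> norm1 f"
proof -
  have "norm (fourier f t) \<le> (LINT x|lborel. norm (wave (- t) x * f x))"
    unfolding fourier_wave by (rule integral_norm_bound)
  then show ?thesis by (simp add: norm_mult norm1_def)
qed

lemma continuous_wave_integral:
  assumes "integrable lborel f" shows "isCont (\<lambda>s. LINT x|lborel. wave s x * f x) t"
  unfolding continuous_at_sequentially comp_def
proof (intro allI impI)
  fix X assume X: "X \<longlonglongrightarrow> t"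
  show "(\<lambda>n. LINT x|lborel. wave (X n) x * f x) \<longlonglongrightarrow> (LINT x|lborel. wave t x * f x)"
  proof (rule integral_dominated_convergence[where w = "\<lambda>x. norm (f x)"])
    show "AE x in lborel. (\<lambda>n. wave (X n) x * f x) \<longlonglongrightarrow> wave t x * f x"
      unfolding wave_def by (intro AE_I2 tendsto_intros X)
  qed (use assms in \<open>auto simp: norm_mult\<close>)
qed

lemma isCont_fourier:
  assumes "integrable lborel f" shows "isCont (fourier f) t"
proof -
  have "isCont (\<lambda>s. LINT x|lborel. wave s x * f x) (- t)"
    by (rule continuous_wave_integral[OF assms])
  then have "isCont (\<lambda>t. LINT x|lborel. wave (- t) x * f x) t"
    by (rule isCont_o2[rotated]) simp
  then show ?thesis by (simp add: fourier_wave[abs_def])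
qed

section \<open>Fourier inversion\<close>

definition levy_kernel :: "real \<Rightarrow> real \<Rightarrow> real \<Rightarrow> complex" where
  "levy_kernel a b t = (iexp (- (t * a)) - iexp (- (t * b))) / (\<i> * t)"

definition levy_char :: "(real \<Rightarrow> complex) \<Rightarrow> real \<Rightarrow> complex" where
  "levy_char g t = (LINT x|lborel. wave (t / (2 * pi)) x * g x)"

text \<open>
  The inversion formula for the mass of an interval, for one integrable function. The formula is additive and
  homogeneous in \<open>g\<close>, so it passes from probability densities, where it is Levy's theorem, to complex
  functions.
\<close>

definition levy_limit :: "real \<Rightarrow> real \<Rightarrow> (real \<Rightarrow> complex) \<Rightarrow> bool" where
  "levy_limit a b g \<longleftrightarrow>
    (\<lambda>T::nat. LINT t:{- real T<..<real T}|lborel. levy_kernel a b t * levy_char g t)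
      \<longlonglongrightarrow> 2 * complex_of_real pi * (LINT x:{a<..b}|lborel. g x)"

lemma levy_kernel_measurable [measurable]: "levy_kernel a b \<in> borel_measurable borel"
  unfolding levy_kernel_def by measurable

lemma norm_levy_kernel: assumes "a \<le> b" shows "norm (levy_kernel a b t) \<le> b - a"
proof (cases "t = 0")
  case False
  then show ?thesis
    using Levy_Inversion_aux2[of "-b" "-a" t] assms by (simp add: levy_kernel_def)
qed (use assms in \<open>simp add: levy_kernel_def\<close>)

lemma levy_integrable:
  assumes "a \<le> b" "integrable lborel g"
  shows "set_integrable lborel {- real T<..<real T}
    (\<lambda>t. levy_kernel a b t * levy_char g t)"
proof -
  have m: "(\<lambda>t. levy_char g t) \<in> borel_measurable borel"
  proof (intro borel_measurable_continuous_onI continuous_at_imp_continuous_on ballI)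
    fix t
    show "isCont (\<lambda>t. levy_char g t) t"
      unfolding levy_char_def
      by (rule isCont_o2[OF _ continuous_wave_integral[OF assms(2)]]) simp
  qed
  have "norm (levy_char g t) \<le> norm1 g" for t
    using norm_fourier_le[OF assms(2), of "- (t / (2 * pi))"] by (simp add: fourier_wave levy_char_def)
  then have "norm (levy_kernel a b t * levy_char g t) \<le> (b - a) * norm1 g" for t
    unfolding norm_mult using norm_levy_kernel[OF assms(1)] assms(1) by (intro mult_mono) auto
  then show ?thesis
    unfolding set_integrable_def
    by (intro integrableI_bounded_set_indicator[where B = "(b - a) * norm1 g"])
       (use m in auto)
qed

lemma levy_limit_add:
  assumes "a \<le> b" "integrable lborel g" "integrable lborel h" "levy_limit a b g" "levy_limit a b h"
  shows "levy_limit a b (\<lambda>x. g x + h x)"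
proof -
  have *: "levy_char (\<lambda>x. g x + h x) t =
      levy_char g t + levy_char h t" for t
    unfolding levy_char_def distrib_left
    by (rule Bochner_Integration.integral_add) (simp_all add: assms)
  have s: "set_integrable lborel {a<..b} g" "set_integrable lborel {a<..b} h"
    unfolding set_integrable_def by (intro integrable_mult_indicator assms; simp)+
  show ?thesis
    using tendsto_add[OF assms(4,5)[unfolded levy_limit_def]]
    unfolding levy_limit_def * distrib_left
    by (subst (asm) set_integral_add(2)[OF levy_integrable levy_integrable, symmetric])
       (simp_all add: assms set_integral_add(2)[OF s] distrib_left)
qed

lemma levy_limit_cmult:
  assumes "levy_limit a b g" shows "levy_limit a b (\<lambda>x. c * g x)"
proof -
  have "levy_char (\<lambda>x. c * g x) t = c * levy_char g t" for t
    by (simp add: levy_char_def mult.left_commute)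
  then show ?thesis
    using tendsto_mult_left[OF assms[unfolded levy_limit_def], of c]
    by (simp add: levy_limit_def mult.left_commute)
qed

text \<open>
  A nonnegative integrable function is a multiple of a probability density, and its distribution has no atoms,
  so Levy's inversion theorem applies at all endpoints.
\<close>

lemma levy_limit_nonneg:
  fixes p :: "real \<Rightarrow> real"
  assumes "a \<le> b" and p: "integrable lborel p" "\<And>x. 0 \<le> p x"
  shows "levy_limit a b (\<lambda>x. of_real (p x))"
proof (cases "(LINT x|lborel. p x) = 0")
  case True
  then have "AE x in lborel. p x = 0"
    using p by (subst (asm) integral_nonneg_eq_0_iff_AE) auto
  then have ae: "AE x in lborel. complex_of_real (p x) = 0" by simp
  have 1: "levy_char (\<lambda>x. of_real (p x)) t = 0" for t
    unfolding levy_char_def by (rule integral_eq_zero_AE) (use ae in auto)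
  have 2: "(LINT x:{a<..b}|lborel. complex_of_real (p x)) = 0"
    unfolding set_lebesgue_integral_def by (rule integral_eq_zero_AE) (use ae in auto)
  show ?thesis by (simp add: levy_limit_def 1 2)
next
  case False
  define m where "m = (LINT x|lborel. p x)"
  have m: "m > 0" using False p unfolding m_def by (simp add: order_less_le)
  define M where "M = density lborel (\<lambda>x. ennreal (p x / m))"
  have pm[measurable]: "p \<in> borel_measurable borel" using p by auto
  have "emeasure M (space M) = ennreal (LINT x|lborel. p x / m)"
    unfolding M_def using p m by (subst emeasure_density) (auto simp: nn_integral_eq_integral)
  also have "\<dots> = 1" using m by (simp add: m_def)
  finally interpret real_distribution M
    unfolding real_distribution_def real_distribution_axioms_def
    by (auto simp: M_def intro!: prob_spaceI)
  have int: "integral\<^sup>L M f = (LINT x|lborel. (p x / m) *\<^sub>R f x)" if "f \<in> borel_measurable borel"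
    for f :: "real \<Rightarrow> complex"
    unfolding M_def using that p m by (subst integral_density) auto
  have char: "char M t = levy_char (\<lambda>x. of_real (p x)) t / m" for t
    unfolding char_def by (subst int) (auto simp: scaleR_conv_of_real mult_ac levy_char_def wave_def)
  have meas: "complex_of_real (measure M {a<..b}) = (LINT x:{a<..b}|lborel. complex_of_real (p x)) / m"
  proof -
    have "complex_of_real (measure M {a<..b}) = (LINT x|M. complex_of_real (indicator {a<..b} x))"
      by (simp add: M_def)
    also have "\<dots> = (LINT x:{a<..b}|lborel. complex_of_real (p x)) / m"
      unfolding set_lebesgue_integral_def
      by (subst int) (auto simp: scaleR_conv_of_real mult.commute)
    finally show ?thesis .
  qed
  have null: "measure M {c} = 0" for c
    unfolding measure_def M_def by (subst emeasure_density) (auto simp: nn_integral_null_set)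
  have "(\<lambda>T. 1 / (2 * pi) * (CLBINT t=-T..T. (iexp (-(t * a)) - iexp (-(t * b))) / (\<i> * t) * char M t))
      \<longlonglongrightarrow> measure M {a<..b}"
    by (rule Levy_Inversion) (use assms null in auto)
  then have "(\<lambda>T. 1 / (2 * pi) * (LINT t:{- real T<..<real T}|lborel. levy_kernel a b t * char M t))
      \<longlonglongrightarrow> measure M {a<..b}"
    by (simp add: interval_lebesgue_integral_def levy_kernel_def einterval_eq)
  from tendsto_mult_left[OF this, of "2 * pi * m"]
  have "(\<lambda>T. of_real m * (LINT t:{- real T<..<real T}|lborel. levy_kernel a b t * char M t))
      \<longlonglongrightarrow> 2 * pi * m * measure M {a<..b}" by (simp add: mult.assoc mult.left_commute)
  moreover have "of_real m * (LINT t:A|lborel. levy_kernel a b t * char M t) =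
      (LINT t:A|lborel. levy_kernel a b t * levy_char (\<lambda>x. of_real (p x)) t)" for A
    using m by (simp add: char)
  ultimately show ?thesis
    using m by (simp add: levy_limit_def meas mult.assoc)
qed

lemma levy_limit_integrable:
  assumes "a \<le> b" and g: "integrable lborel g"
  shows "levy_limit a b g"
proof -
  have pos: "levy_limit a b (\<lambda>x. c * of_real (max 0 (q x)))" 
    "integrable lborel (\<lambda>x. c * complex_of_real (max 0 (q x)))" 
    if "integrable lborel q" for q c
    using that assms by (auto intro!: levy_limit_cmult levy_limit_nonneg)
  have "levy_limit a b (\<lambda>x. ((1 * of_real (max 0 (Re (g x))) + (- 1) * of_real (max 0 (- Re (g x))))
     + \<i> * of_real (max 0 (Im (g x)))) + (- \<i>) * of_real (max 0 (- Im (g x))))"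
    using g by (intro levy_limit_add assms Bochner_Integration.integrable_add pos) auto
  moreover have "((1 * of_real (max 0 (Re (g x))) + (- 1) * of_real (max 0 (- Re (g x))))
     + \<i> * of_real (max 0 (Im (g x)))) + (- \<i>) * of_real (max 0 (- Im (g x))) = g x" for x
    by (auto simp: complex_eq_iff)
  ultimately show ?thesis by simp
qed


lemma levy_kernel_integral:
  assumes "a \<le> b" "t \<noteq> 0"
  shows "levy_kernel a b t = (LINT s:{a<..b}|lborel. iexp (- (t * s)))"
proof -
  have "(LBINT s=a..b. iexp (- (t * s))) = iexp (- (t * b)) / (- \<i> * t) - iexp (- (t * a)) / (- \<i> * t)"
  proof (rule interval_integral_FTC_finite)
    show "continuous_on {min a b..max a b} (\<lambda>s. iexp (- (t * s)))" by (intro continuous_intros)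
    fix s
    have "((\<lambda>z. exp (\<i> * (- (of_real t * z))) / (- \<i> * of_real t)) has_field_derivative iexp (- (t * s)))
        (at (of_real s))"
      using assms by (auto intro!: derivative_eq_intros simp: mult_ac)
    then have "((\<lambda>s. iexp (- (t * s)) / (- \<i> * of_real t)) has_vector_derivative iexp (- (t * s))) (at s)"
      by (auto dest!: has_vector_derivative_real_field)
    then show "((\<lambda>s. iexp (- (t * s)) / (- \<i> * of_real t)) has_vector_derivative iexp (- (t * s)))
        (at s within {min a b..max a b})"
      by (rule has_vector_derivative_at_within)
  qed
  then show ?thesis
    using assms by (simp add: levy_kernel_def interval_integral_Ioc field_simps)
qed

text \<open>
  Integrability of the transform turns the limit over symmetric intervals into an integral over the line. The
  kernel is itself an integral of exponentials over \<open>{a<..b}\<close>, so Fubini's theorem exhibits the inverse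
  transform.
\<close>

lemma fourier_inversion_interval:
  assumes "a \<le> b" and g: "integrable lborel g" and gh: "integrable lborel (fourier g)"
  shows "(LINT s:{a<..b}|lborel. LINT t|lborel. wave s t * fourier g t) = (LINT x:{a<..b}|lborel. g x)"
proof -
  have fl: "levy_char g t = fourier g (- t / (2 * pi))" for t
    by (simp add: levy_char_def fourier_wave)
  have H: "integrable lborel (levy_char g)"
    using lborel_integrable_real_affine[OF gh, of "- 1 / (2 * pi)" 0] by (simp add: fl[abs_def])
  have Hm[measurable]: "levy_char g \<in> borel_measurable borel" using H by auto
  have KH: "integrable lborel (\<lambda>t. levy_kernel a b t * levy_char g t)"
  proof (rule Bochner_Integration.integrable_bound)
    show "integrable lborel (\<lambda>t. (b - a) * norm (levy_char g t))" using H by simp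
    show "AE t in lborel. norm (levy_kernel a b t * levy_char g t) \<le> norm ((b - a) * norm (levy_char g t))"
      using norm_levy_kernel[OF assms(1)] assms(1) by (auto simp: norm_mult intro!: mult_right_mono)
  qed measurable
  have "(\<lambda>T::nat. LINT t:{- real T<..<real T}|lborel. levy_kernel a b t * levy_char g t)
      \<longlonglongrightarrow> (LINT t|lborel. levy_kernel a b t * levy_char g t)"
    unfolding set_lebesgue_integral_def
  proof (rule integral_dominated_convergence[where w = "\<lambda>t. norm (levy_kernel a b t * levy_char g t)"])
    show "AE t in lborel. (\<lambda>T::nat. indicator {- real T<..<real T} t *\<^sub>R (levy_kernel a b t * levy_char g t))
        \<longlonglongrightarrow> levy_kernel a b t * levy_char g t"
    proof (rule AE_I2, rule tendsto_eventually)
      fix t :: real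
      have "eventually (\<lambda>T::nat. \<bar>t\<bar> < real T) sequentially"
        using filterlim_real_sequentially by (simp add: filterlim_at_top_dense)
      then show "eventually (\<lambda>T::nat. indicator {- real T<..<real T} t *\<^sub>R (levy_kernel a b t * levy_char g t)
          = levy_kernel a b t * levy_char g t) sequentially"
        by eventually_elim (auto simp: indicator_def)
    qed
  qed (use KH in \<open>auto simp: indicator_def\<close>)
  with levy_limit_integrable[OF assms(1,2)]
  have "2 * of_real pi * (LINT x:{a<..b}|lborel. g x) = (LINT t|lborel. levy_kernel a b t * levy_char g t)"
    unfolding levy_limit_def using LIMSEQ_unique by blast
  also have "\<dots> = (LINT t|lborel. LINT s|lborel. indicator {a<..b} s *\<^sub>R (iexp (- (t * s)) * levy_char g t))"
  proof (rule integral_cong_AE)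
    have "AE t in lborel. t \<noteq> (0::real)" by (rule AE_lborel_singleton)
    then show "AE t in lborel. levy_kernel a b t * levy_char g t =
        (LINT s|lborel. indicator {a<..b} s *\<^sub>R (iexp (- (t * s)) * levy_char g t))"
      by eventually_elim
        (simp add: levy_kernel_integral[OF assms(1)] set_lebesgue_integral_def mult_scaleR_left[symmetric]
          del: mult_scaleR_left)
  qed measurable
  also have "\<dots> = (LINT s|lborel. LINT t|lborel. indicator {a<..b} s *\<^sub>R (iexp (- (t * s)) * levy_char g t))"
  proof (rule lborel_pair.Fubini_integral, rule lborel_pair.Fubini_integrable)
    show "integrable lborel (\<lambda>s. LINT t|lborel. norm (case (s, t) of (s, t) \<Rightarrow>
        indicator {a<..b} s *\<^sub>R (iexp (- (t * s)) * levy_char g t)))"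
      by (simp add: norm_mult) (intro disjI2 integrable_real_indicator, auto simp: assms(1))
    show "AE s in lborel. integrable lborel (\<lambda>t. case (s, t) of (s, t) \<Rightarrow>
        indicator {a<..b} s *\<^sub>R (iexp (- (t * s)) * levy_char g t))"
    proof (rule AE_I2)
      fix s
      have "integrable lborel (\<lambda>t. iexp (- (t * s)) * levy_char g t)"
        by (rule Bochner_Integration.integrable_bound[OF H]) (auto simp: norm_mult)
      then show "integrable lborel (\<lambda>t. case (s, t) of (s, t) \<Rightarrow>
          indicator {a<..b} s *\<^sub>R (iexp (- (t * s)) * levy_char g t))" by simp
    qed
  qed measurable
  also have "\<dots> = 2 * of_real pi * (LINT s:{a<..b}|lborel. LINT t|lborel. wave s t * fourier g t)"
  proof -
    have "(LINT t|lborel. iexp (- (t * s)) * levy_char g t)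
        = 2 * of_real pi * (LINT t|lborel. wave s t * fourier g t)" for s
      using lborel_integral_real_affine[of "- 2 * pi" "\<lambda>t. iexp (- (t * s)) * levy_char g t" 0]
      by (simp add: fl wave_def scaleR_conv_of_real mult_ac)
    then show ?thesis
      by (simp only: set_lebesgue_integral_def integral_scaleR_right)
        (simp only: mult_scaleR_right[symmetric] integral_mult_right_zero)
  qed
  finally show ?thesis by simp
qed

text \<open>
  Intervals generate the Borel sets, so on each bounded interval all set integrals of \<open>D\<close> vanish.
\<close>

lemma AE_eq_0_if_interval_integrals_0:
  fixes D :: "real \<Rightarrow> complex"
  assumes [measurable]: "D \<in> borel_measurable borel"
    and int: "\<And>a b. set_integrable lborel {a..b} D"
    and zero: "\<And>a b. a \<le> b \<Longrightarrow> (LINT x:{a<..b}|lborel. D x) = 0"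
  shows "AE x in lborel. D x = 0"
proof -
  have *: "AE x in lborel. indicator {-real n..real n} x *\<^sub>R D x = 0" for n
  proof (rule sigma_finite_measure.density_zero[OF lborel.sigma_finite_measure_axioms])
    let ?D = "\<lambda>x. indicator {-real n..real n} x *\<^sub>R D x"
    show D: "integrable lborel ?D"
      using int[of "-real n" "real n"] by (simp add: set_integrable_def)
    have si: "set_integrable lborel A ?D" if "A \<in> sets borel" for A
      unfolding set_integrable_def using that by (intro integrable_mult_indicator D) auto
    have Icc: "(LINT x:{a..b}|lborel. D x) = 0" for a b
    proof (cases "a \<le> b")
      case True
      have "(LINT x:{a..b}|lborel. D x) = (LINT x:{a<..b}|lborel. D x)"
        unfolding set_lebesgue_integral_def
      proof (rule integral_cong_AE)
        have "AE x in lborel. x \<noteq> a" by (rule AE_lborel_singleton)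
        then show "AE x in lborel. indicator {a..b} x *\<^sub>R D x = indicator {a<..b} x *\<^sub>R D x"
          by eventually_elim (auto simp: indicator_def)
      qed measurable
      then show ?thesis using zero[OF True] by simp
    qed (simp add: set_lebesgue_integral_def)
    have "(LINT x:A|lborel. ?D x) = 0" if "A \<in> sets borel" for A
      using that
    proof (induction rule: borel_set_induct)
      case (interval a b)
      have "(LINT x:{a..b}|lborel. ?D x) = (LINT x:{max a (- real n)..min b (real n)}|lborel. D x)"
        unfolding set_lebesgue_integral_def
        by (intro Bochner_Integration.integral_cong) (auto simp: indicator_def)
      then show ?case using Icc by simp
    next
      case (compl A)
      have "(LINT x:A \<union> - A|lborel. ?D x) = (LINT x:A|lborel. ?D x) + (LINT x:- A|lborel. ?D x)"
        using compl by (intro set_integral_Un si) auto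
      moreover have "(LINT x:A \<union> - A|lborel. ?D x) = (LINT x:{-real n..real n}|lborel. D x)"
        by (simp add: set_lebesgue_integral_def)
      ultimately show ?case using compl Icc by simp
    next
      case (union f)
      have "(LINT x:(\<Union>i. f i)|lborel. ?D x) = (\<Sum>i. (LINT x:f i|lborel. ?D x))"
        using union by (intro lebesgue_integral_countable_add si sets.countable_UN)
          (auto simp: disjoint_family_on_def)
      then show ?case using union by simp
    qed (simp add: set_lebesgue_integral_def)
    then show "(LINT x:A|lborel. ?D x) = 0" if "A \<in> sets lborel" for A
      using that by simp
  qed
  have "AE x in lborel. \<forall>n. indicator {-real n..real n} x *\<^sub>R D x = 0"
    unfolding AE_all_countable using * by blast
  then show ?thesis
  proof eventually_elim
    case (elim x)
    obtain n where "\<bar>x\<bar> \<le> real n" using real_arch_simple by blast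
    with elim[rule_format, of n] show ?case by (auto simp: indicator_def abs_le_iff split: if_splits)
  qed
qed

lemma fourier_inversion:
  assumes g: "integrable lborel g" and gh: "integrable lborel (fourier g)"
  shows "AE x in lborel. g x = (LINT t|lborel. wave x t * fourier g t)"
proof -
  let ?G = "\<lambda>x. LINT t|lborel. wave x t * fourier g t"
  have cont: "continuous_on UNIV ?G"
    by (intro continuous_at_imp_continuous_on ballI continuous_wave_integral gh)
  have G: "set_integrable lborel {a..b} ?G" for a b
    by (intro borel_integrable_atLeastAtMost' continuous_on_subset[OF cont]) simp
  have gi: "set_integrable lborel A g" if "A \<in> sets borel" for A
    unfolding set_integrable_def using that by (intro integrable_mult_indicator g) auto
  have G': "set_integrable lborel {a<..b} ?G" for a b
    by (rule set_integrable_subset[OF G[of a b]]) auto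
  have "AE x in lborel. g x - ?G x = 0"
  proof (rule AE_eq_0_if_interval_integrals_0)
    show "(\<lambda>x. g x - ?G x) \<in> borel_measurable borel"
      using g borel_measurable_continuous_onI[OF cont] by (intro borel_measurable_diff) auto
    show "set_integrable lborel {a..b} (\<lambda>x. g x - ?G x)" for a b
      by (intro set_integral_diff G gi) simp
    show "(LINT x:{a<..b}|lborel. g x - ?G x) = 0" if "a \<le> b" for a b
      using fourier_inversion_interval[OF that g gh]
      by (subst set_integral_diff) (auto intro: G' gi)
  qed
  then show ?thesis by simp
qed

section \<open>Band-limited functions and their entire extensions\<close>

lemma PW1_iff:
  assumes "closed S"
  shows "f \<in> PW1 S \<longleftrightarrow> integrable lborel f \<and> (\<forall>t. t \<notin> S \<longrightarrow> fourier f t = 0)"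
  using assms closure_minimal[of "{t. fourier f t \<noteq> 0}" S] closure_subset[of "{t. fourier f t \<noteq> 0}"]
  by (auto simp: PW1_def Sp_def)

lemma PW1_mono: "f \<in> PW1 A \<Longrightarrow> A \<subseteq> B \<Longrightarrow> f \<in> PW1 B"
  by (auto simp: PW1_def)

lemma PW1_add:
  "closed S \<Longrightarrow> f \<in> PW1 S \<Longrightarrow> g \<in> PW1 S \<Longrightarrow> (\<lambda>x. f x + g x) \<in> PW1 S"
  by (simp add: PW1_iff fourier_add)

lemma PW1_cmult: "closed S \<Longrightarrow> f \<in> PW1 S \<Longrightarrow> (\<lambda>x. c * f x) \<in> PW1 S"
  by (simp add: PW1_iff fourier_cmult)

lemma PW1_diff:
  "closed S \<Longrightarrow> f \<in> PW1 S \<Longrightarrow> g \<in> PW1 S \<Longrightarrow> (\<lambda>x. f x - g x) \<in> PW1 S"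
  by (simp add: PW1_iff fourier_diff)

lemma norm1_cmult: "norm1 (\<lambda>x. c * f x) = norm c * norm1 f"
  by (simp add: norm1_def norm_mult)

lemma norm1_nonneg: "norm1 f \<ge> 0"
  by (simp add: norm1_def)

lemma norm1_pos:
  assumes "integrable lborel f" "fourier f t \<noteq> 0" shows "norm1 f > 0"
  using norm_fourier_le[OF assms(1), of t] assms(2) zero_less_norm_iff[of "fourier f t"] by linarith

definition cwave :: "real \<Rightarrow> complex \<Rightarrow> complex" where
  "cwave t z = exp (2 * of_real pi * \<i> * of_real t * z)"

lemma cwave_of_real: "cwave t (of_real x) = wave t x"
  by (simp add: cwave_def wave_def)

lemma cwave_add: "cwave (s + t) z = cwave s z * cwave t z"
  by (simp add: cwave_def ring_distribs exp_add)

lemma cwave_minus: "cwave (- t) z = inverse (cwave t z)"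
  by (simp add: cwave_def exp_minus)

lemma cwave_double: "cwave (2 * t) z = (cwave t z)\<^sup>2"
  using cwave_add[of t t z] by (simp only: mult_2 power2_eq_square)

lemma cwave_nonzero [simp]: "cwave t z \<noteq> 0"
  by (simp add: cwave_def)

lemma norm_cwave: "norm (cwave t z) = exp (- 2 * pi * t * Im z)"
  by (simp add: cwave_def norm_exp_eq_Re)

lemma cwave_has_field_derivative [derivative_intros]:
  "(f has_field_derivative f') (at x within A) \<Longrightarrow>
    ((\<lambda>x. cwave t (f x)) has_field_derivative (2 * of_real pi * \<i> * of_real t * f' * cwave t (f x))) (at x within A)"
  unfolding cwave_def by (auto intro!: derivative_eq_intros)

lemma cwave_holomorphic [holomorphic_intros]:
  "f holomorphic_on A \<Longrightarrow> (\<lambda>z. cwave t (f z)) holomorphic_on A"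
  unfolding cwave_def by (intro holomorphic_intros)

lemma continuous_on_cwave [continuous_intros]:
  "continuous_on A f \<Longrightarrow> continuous_on A g \<Longrightarrow> continuous_on A (\<lambda>x. cwave (f x) (g x))"
  unfolding cwave_def by (intro continuous_intros)

lemma cwave_integral_holomorphic:
  assumes "continuous_on {l..u} \<Phi>"
  shows "(\<lambda>z. integral {l..u} (\<lambda>t. \<Phi> t * cwave t z)) holomorphic_on UNIV"
proof -
  have "(\<lambda>z. integral (cbox l u) (\<lambda>t. \<Phi> t * cwave t z)) holomorphic_on UNIV"
  proof (rule leibniz_rule_holomorphic)
    show "((\<lambda>z. \<Phi> t * cwave t z) has_field_derivative \<Phi> t * (2 * of_real pi * \<i> * of_real t * 1 * cwave t z)) (at z within UNIV)" for z t
      by (rule DERIV_cmult[OF cwave_has_field_derivative[OF DERIV_ident]])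
    show "(\<lambda>t. \<Phi> t * cwave t z) integrable_on cbox l u" for z
      using assms by (intro integrable_continuous continuous_intros) simp
    have "continuous_on (UNIV \<times> cbox l u) (\<lambda>p. \<Phi> (snd p))"
      using assms by (intro continuous_on_compose2[OF _ continuous_on_snd[OF continuous_on_id]]) auto
    then show "continuous_on (UNIV \<times> cbox l u) (\<lambda>(z, t). \<Phi> t * (2 * of_real pi * \<i> * of_real t * 1 * cwave t z))"
      by (auto simp: case_prod_unfold intro!: continuous_intros)
  qed auto
  then show ?thesis by simp
qed

text \<open>
  The inversion integral runs over \<open>{- \<sigma>..\<sigma>}\<close> only and makes sense for complex arguments; its integrand grows
  at most like the exponential in the bound.
\<close>

lemma PW1_entire_extension:
  assumes g: "g \<in> PW1 S" and S: "closed S" "S \<subseteq> {- \<sigma>..\<sigma>}"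
  obtains G where "G holomorphic_on UNIV" "eq_ae g (\<lambda>x. G (of_real x))"
    "\<And>z. norm (G z) \<le> 2 * \<sigma> * norm1 g * exp (2 * pi * \<sigma> * \<bar>Im z\<bar>)"
proof (cases "\<sigma> \<ge> 0")
  case False
  then have "S = {}" using S by auto
  then have "fourier g = (\<lambda>_. 0)" using g by (auto simp: PW1_iff)
  moreover have gi: "integrable lborel g" using g by (simp add: PW1_def)
  ultimately have "AE x in lborel. g x = 0"
    using fourier_inversion[OF gi] by simp
  then have "eq_ae g (\<lambda>x. (\<lambda>_. 0) (complex_of_real x))" "norm1 g = 0"
    unfolding eq_ae_def norm1_def by (auto intro!: integral_eq_zero_AE)
  then show ?thesis by (intro that[of "\<lambda>_. 0"]) auto
next
  case True
  have gi: "integrable lborel g" and zero: "\<And>t. t \<notin> {- \<sigma>..\<sigma>} \<Longrightarrow> fourier g t = 0"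
    using g S by (auto simp: PW1_iff[OF S(1)])
  have cont: "continuous_on A (fourier g)" for A
    by (intro continuous_at_imp_continuous_on ballI isCont_fourier gi)
  have eq: "fourier g t = indicator {- \<sigma>..\<sigma>} t *\<^sub>R fourier g t" for t
    using zero[of t] by (auto simp: indicator_def)
  have "set_integrable lborel {- \<sigma>..\<sigma>} (fourier g)"
    by (rule borel_integrable_atLeastAtMost'[OF cont])
  then have fi: "integrable lborel (fourier g)"
    unfolding set_integrable_def eq[symmetric] .
  define G where "G = (\<lambda>z. integral {- \<sigma>..\<sigma>} (\<lambda>t. fourier g t * cwave t z))"
  show ?thesis
  proof
    show "G holomorphic_on UNIV" unfolding G_def by (rule cwave_integral_holomorphic[OF cont])
    have "(LINT t|lborel. wave x t * fourier g t) = G (of_real x)" for x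
    proof -
      have "(LINT t|lborel. wave x t * fourier g t) = (LINT t:{- \<sigma>..\<sigma>}|lborel. wave x t * fourier g t)"
        unfolding set_lebesgue_integral_def
        by (intro Bochner_Integration.integral_cong refl) (auto simp: indicator_def zero)
      also have "\<dots> = (LINT t:{- \<sigma>..\<sigma>}|lborel. fourier g t * cwave t (of_real x))"
        by (intro set_lebesgue_integral_cong) (auto simp: wave_def cwave_def mult_ac)
      also have "\<dots> = G (of_real x)"
        unfolding G_def
        by (intro set_borel_integral_eq_integral(2) borel_integrable_atLeastAtMost' continuous_intros cont)
      finally show ?thesis .
    qed
    then show "eq_ae g (\<lambda>x. G (of_real x))"
      using fourier_inversion[OF gi fi] by (simp add: eq_ae_def)
    fix z
    have "norm (G z) \<le> norm1 g * exp (2 * pi * \<sigma> * \<bar>Im z\<bar>) * (\<sigma> - (- \<sigma>))"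
      unfolding G_def
    proof (rule integral_bound)
      fix t assume t: "t \<in> {- \<sigma>..\<sigma>}"
      have "- 2 * pi * t * Im z \<le> \<bar>2 * pi * t * Im z\<bar>" by simp
      also have "\<dots> = 2 * pi * \<bar>t\<bar> * \<bar>Im z\<bar>" by (simp add: abs_mult)
      also have "\<dots> \<le> 2 * pi * \<sigma> * \<bar>Im z\<bar>" using t by (intro mult_right_mono mult_left_mono) auto
      finally show "norm (fourier g t * cwave t z) \<le> norm1 g * exp (2 * pi * \<sigma> * \<bar>Im z\<bar>)"
        unfolding norm_mult norm_cwave using norm_fourier_le[OF gi, of t] norm1_nonneg[of g]
        by (intro mult_mono) auto
    next
      show "- \<sigma> \<le> \<sigma>" using True by simp
      show "continuous_on {- \<sigma>..\<sigma>} (\<lambda>t. fourier g t * cwave t z)"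
        by (intro continuous_on_mult cont continuous_on_cwave continuous_on_id continuous_on_const)
    qed
    then show "norm (G z) \<le> 2 * \<sigma> * norm1 g * exp (2 * pi * \<sigma> * \<bar>Im z\<bar>)" by (simp add: mult_ac)
  qed
qed

section \<open>Support functionals and convex combinations in the unit ball\<close>

text \<open>
  Since \<open>h\<close> is bounded below by a positive number, the functions \<open>f \<plusminus> s (f - q)\<close> with small \<open>s\<close> are
  pointwise nonnegative multiples of \<open>q\<close>. So the norm is affine on the segment that they span, and it is
  constant there because \<open>f\<close> and \<open>q\<close> have equal norms.
\<close>

lemma not_Ext_if_ratio_bounded_below:
  assumes S: "closed S" and f: "f \<in> PW1 S" "norm1 f = 1" and q: "q \<in> PW1 S" "norm1 q = 1"
    and ratio: "\<And>x. f x = of_real (h x) * q x" and eps: "\<epsilon> > 0" "\<And>x. \<epsilon> \<le> h x"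
    and ne: "\<not> eq_ae f q"
  shows "f \<notin> Ext_PW1 S"
proof
  assume ext: "f \<in> Ext_PW1 S"
  \<comment> \<open>\<open>s \<le> \<epsilon>\<close> keeps \<open>h (1 + s) - s\<close> nonnegative, and \<open>s \<le> 1\<close> keeps \<open>h (1 - s) + s\<close> nonnegative.\<close>
  define s where "s = min \<epsilon> 1"
  have s: "0 < s" "s \<le> 1" "s \<le> \<epsilon>" using eps by (auto simp: s_def)
  define g1 where "g1 = (\<lambda>x. f x + of_real s * (f x - q x))"
  define g2 where "g2 = (\<lambda>x. f x - of_real s * (f x - q x))"
  have int: "integrable lborel f" "integrable lborel q" using f q by (auto simp: PW1_iff[OF S])
  have n1: "norm (g1 x) = (1 + s) * norm (f x) - s * norm (q x)" for x
  proof -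
    have "s * 1 \<le> h x * (1 + s)" using s eps(2)[of x] by (intro mult_mono) auto
    moreover have "g1 x = of_real (h x * (1 + s) - s) * q x"
      by (simp add: g1_def ratio algebra_simps)
    ultimately have "norm (g1 x) = (h x * (1 + s) - s) * norm (q x)"
      by (simp only: norm_mult norm_of_real abs_of_nonneg diff_ge_0_iff_ge)
    moreover have "norm (f x) = h x * norm (q x)"
      using eps(2)[of x] eps(1) by (simp add: ratio norm_mult)
    ultimately show ?thesis by (simp add: algebra_simps)
  qed
  have n2: "norm (g2 x) = (1 - s) * norm (f x) + s * norm (q x)" for x
  proof -
    have "0 \<le> h x * (1 - s) + s" using s eps(1) eps(2)[of x] by (intro add_nonneg_nonneg mult_nonneg_nonneg) auto
    moreover have "g2 x = of_real (h x * (1 - s) + s) * q x"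
      by (simp add: g2_def ratio algebra_simps)
    ultimately have "norm (g2 x) = (h x * (1 - s) + s) * norm (q x)"
      by (simp only: norm_mult norm_of_real abs_of_nonneg diff_ge_0_iff_ge)
    moreover have "norm (f x) = h x * norm (q x)"
      using eps(2)[of x] eps(1) by (simp add: ratio norm_mult)
    ultimately show ?thesis by (simp add: algebra_simps)
  qed
  have "norm1 g1 = (1 + s) * norm1 f - s * norm1 q" "norm1 g2 = (1 - s) * norm1 f + s * norm1 q"
    unfolding norm1_def n1 n2 using int by auto
  then have "norm1 g1 = 1" "norm1 g2 = 1" by (simp_all add: f q)
  moreover have "g1 \<in> PW1 S" "g2 \<in> PW1 S"
    unfolding g1_def g2_def using S f q by (intro PW1_add PW1_diff PW1_cmult; simp)+
  ultimately have ball: "g1 \<in> ball_PW1 S" "g2 \<in> ball_PW1 S" by (auto simp: ball_PW1_def)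
  have "f x = (1 - 1 / 2) *\<^sub>R g1 x + (1 / 2) *\<^sub>R g2 x" for x
    by (simp add: g1_def g2_def scaleR_conv_of_real field_simps)
  then have mid: "eq_ae f (\<lambda>x. (1 - 1 / 2) *\<^sub>R g1 x + (1 / 2) *\<^sub>R g2 x)"
    unfolding eq_ae_def by (intro AE_I2)
  have "eq_ae g1 g2"
  proof (rule ccontr)
    assume "\<not> eq_ae g1 g2"
    then have "\<not> eq_ae g1 g2 \<and> 0 < (1 / 2 :: real) \<and> (1 / 2 :: real) < 1 \<and>
        eq_ae f (\<lambda>x. (1 - 1 / 2) *\<^sub>R g1 x + (1 / 2) *\<^sub>R g2 x)"
      using mid by simp
    with ball ext show False
      unfolding Ext_PW1_def mem_Collect_eq by blast
  qed
  then have "eq_ae f q"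
    unfolding eq_ae_def
  proof eventually_elim
    case (elim x)
    then have "2 * of_real s * (f x - q x) = 0" by (simp add: g1_def g2_def algebra_simps)
    then show ?case using s by simp
  qed
  with ne show False by simp
qed

lemma dual_le_norm1:
  assumes S: "closed S" and \<phi>: "\<phi> \<in> dual_PW1 S" "dual_norm S \<phi> = 1" and u: "u \<in> PW1 S"
  shows "norm (\<phi> u) \<le> norm1 u"
proof -
  obtain C where C: "\<And>f. f \<in> PW1 S \<Longrightarrow> norm (\<phi> f) \<le> C * norm1 f"
    using \<phi>(1) unfolding dual_PW1_def by blast
  show ?thesis
  proof (cases "norm1 u = 0")
    case False
    then have pos: "norm1 u > 0" using norm1_nonneg[of u] by simp
    define c where "c = complex_of_real (1 / norm1 u)"
    have c: "norm c = 1 / norm1 u" using pos by (simp add: c_def norm_divide)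
    let ?v = "\<lambda>x. c * u x"
    have v: "?v \<in> ball_PW1 S"
      using pos PW1_cmult[OF S u, of c] by (simp add: ball_PW1_def norm1_cmult c)
    have bdd: "bdd_above ((\<lambda>f. norm (\<phi> f)) ` ball_PW1 S)"
    proof (rule bdd_aboveI2)
      fix f assume f: "f \<in> ball_PW1 S"
      then have "norm (\<phi> f) \<le> C * norm1 f" using C by (auto simp: ball_PW1_def)
      also have "\<dots> \<le> \<bar>C\<bar> * 1"
        using f norm1_nonneg[of f] by (intro mult_mono) (auto simp: ball_PW1_def)
      finally show "norm (\<phi> f) \<le> \<bar>C\<bar>" by simp
    qed
    have "norm (\<phi> ?v) \<le> 1"
      using cSUP_upper[OF v bdd] \<phi>(2) by (simp add: dual_norm_def)
    moreover have "\<phi> ?v = c * \<phi> u"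
      using \<phi>(1) u unfolding dual_PW1_def by blast
    ultimately show ?thesis using pos by (simp add: norm_mult c field_simps)
  qed (use C[OF u] in simp)
qed

text \<open>
  The norm is differentiable at \<open>f\<close> in the direction \<open>q\<close>: the difference between
  \<open>norm1 (f - l q)\<close> and \<open>1 - l\<close> is twice the integral of \<open>max 0 (l \<bar>q\<bar> - \<bar>f\<bar>)\<close>, which is \<open>o(l)\<close> by dominated
  convergence. Hence a functional of norm one with value \<open>1\<close> at \<open>f\<close> has value \<open>1\<close> at \<open>q\<close>.
\<close>

lemma not_Exp_if_ratio_nonneg:
  assumes S: "closed S" and f: "f \<in> PW1 S" "norm1 f = 1" and q: "q \<in> PW1 S" "norm1 q = 1"
    and ratio: "\<And>x. f x = of_real (h x) * q x" "\<And>x. 0 \<le> h x" "\<And>x. h x = 0 \<Longrightarrow> q x = 0"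
    and ne: "\<not> eq_ae q f"
  shows "f \<notin> Exp_PW1 S"
proof
  assume "f \<in> Exp_PW1 S"
  then obtain \<phi> where \<phi>: "\<phi> \<in> dual_PW1 S" "dual_norm S \<phi> = 1"
    and exposes: "{g \<in> ball_PW1 S. \<phi> g = 1} = {g \<in> ball_PW1 S. eq_ae g f}"
    by (auto simp: Exp_PW1_def)
  have fb: "f \<in> ball_PW1 S" and qb: "q \<in> ball_PW1 S" using f q by (auto simp: ball_PW1_def)
  have "eq_ae f f" by (simp add: eq_ae_def)
  then have \<phi>f: "\<phi> f = 1" using exposes fb by blast
  have int: "integrable lborel f" "integrable lborel q" using f q by (auto simp: PW1_iff[OF S])
  have [measurable]: "f \<in> borel_measurable borel" "q \<in> borel_measurable borel" using int by auto
  define d where "d = (\<lambda>n x. max 0 (norm (q x) - real (Suc n) * norm (f x)))"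
  have d_int: "integrable lborel (d n)" for n
  proof (rule Bochner_Integration.integrable_bound)
    show "integrable lborel (\<lambda>x. norm (q x))" using int by simp
  qed (auto simp: d_def)
  have key: "1 - Re (\<phi> q) \<le> 2 * (LINT x|lborel. d n x)" for n
  proof -
    define l where "l = 1 / real (Suc n)"
    have l: "l > 0" by (simp add: l_def)
    have pointwise: "norm (f x - of_real l * q x) = norm (f x) - l * norm (q x) + 2 * l * d n x" for x
    proof -
      have "f x - of_real l * q x = of_real (h x - l) * q x" by (simp add: ratio(1) algebra_simps)
      then have 1: "norm (f x - of_real l * q x) = \<bar>h x - l\<bar> * norm (q x)"
        by (simp only: norm_mult norm_of_real)
      have 2: "norm (f x) = h x * norm (q x)" using ratio(2)[of x] by (simp add: ratio(1) norm_mult)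
      have "l * d n x = max 0 (l * norm (q x) - norm (f x))"
        unfolding d_def using l by (subst max_mult_distrib_left) (simp add: right_diff_distrib l_def)
      also have "\<dots> = max 0 ((l - h x) * norm (q x))" by (simp add: 2 algebra_simps)
      also have "\<dots> = max 0 (l - h x) * norm (q x)" by (simp add: max_mult_distrib_right)
      finally have 3: "l * d n x = max 0 (l - h x) * norm (q x)" .
      show ?thesis
        unfolding 1 2 mult.assoc 3 by (cases "h x \<le> l") (auto simp: algebra_simps)
    qed
    have "Re (\<phi> (\<lambda>x. f x - of_real l * q x)) \<le> norm1 (\<lambda>x. f x - of_real l * q x)"
      using dual_le_norm1[OF S \<phi> PW1_diff[OF S f(1) PW1_cmult[OF S q(1)]], of "of_real l"]
      by (meson complex_Re_le_cmod order_trans)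
    also have "\<dots> = 1 - l + 2 * l * (LINT x|lborel. d n x)"
      unfolding norm1_def pointwise using int d_int f(2) q(2) by (simp add: norm1_def)
    also have "\<phi> (\<lambda>x. f x - of_real l * q x) = \<phi> f - of_real l * \<phi> q"
    proof -
      have add: "\<phi> (\<lambda>x. a x + b x) = \<phi> a + \<phi> b" if "a \<in> PW1 S" "b \<in> PW1 S" for a b
        using \<phi>(1) that unfolding dual_PW1_def by blast
      have "\<phi> (\<lambda>x. f x + (- of_real l) * q x) = \<phi> f + \<phi> (\<lambda>x. (- of_real l) * q x)"
        by (rule add[OF f(1) PW1_cmult[OF S q(1)]])
      also have "\<phi> (\<lambda>x. (- of_real l) * q x) = (- of_real l) * \<phi> q"
        using \<phi>(1) q(1) unfolding dual_PW1_def by blast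
      finally show ?thesis by simp
    qed
    finally have "l * (1 - Re (\<phi> q)) \<le> l * (2 * (LINT x|lborel. d n x))"
      by (simp add: \<phi>f algebra_simps)
    then show ?thesis using l by simp
  qed
  have "(\<lambda>n. LINT x|lborel. d n x) \<longlonglongrightarrow> integral\<^sup>L lborel (\<lambda>x::real. 0::real)"
  proof (rule integral_dominated_convergence[where w = "\<lambda>x. norm (q x)"])
    show "AE x in lborel. (\<lambda>n. d n x) \<longlonglongrightarrow> 0"
    proof (rule AE_I2, rule tendsto_eventually)
      fix x
      show "eventually (\<lambda>n. d n x = 0) sequentially"
      proof (cases "h x = 0")
        case False
        obtain N where N: "1 / h x < real N" using reals_Archimedean2 by blast
        have hx: "h x > 0" using False ratio(2)[of x] by simp
        have "d n x = 0" if "n \<ge> N" for n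
        proof -
          have "1 \<le> real (Suc n) * h x" using N that hx by (simp add: field_simps)
             (smt (verit) mult_mono of_nat_mono of_nat_0_le_iff)
          then have "1 * norm (q x) \<le> real (Suc n) * h x * norm (q x)" by (rule mult_right_mono) simp
          then show ?thesis using hx by (simp add: d_def ratio(1) norm_mult mult.assoc)
        qed
        then show ?thesis by (auto simp: eventually_sequentially)
      qed (use ratio(3) in \<open>simp add: d_def\<close>)
    qed
    show "AE x in lborel. norm (d n x) \<le> norm (q x)" for n by (auto simp: d_def)
  qed (use int in \<open>auto simp: d_def\<close>)
  then have "(\<lambda>n. 2 * (LINT x|lborel. d n x)) \<longlonglongrightarrow> 2 * 0"
    by (intro tendsto_mult tendsto_const) simp
  then have "1 - Re (\<phi> q) \<le> 2 * 0"
    by (rule LIMSEQ_le_const) (use key in auto)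
  then have "Re (\<phi> q) \<ge> 1" by simp
  moreover have "norm (\<phi> q) \<le> 1" using dual_le_norm1[OF S \<phi> q(1)] q(2) by simp
  ultimately have "\<phi> q = 1"
    using complex_Re_le_cmod[of "\<phi> q"] cmod_power2[of "\<phi> q"]
    by (smt (verit) complex_eq_iff one_complex.sel power2_eq_1_iff power_mono zero_le_power2 zero_eq_power2 one_power2)
  then have "q \<in> {g \<in> ball_PW1 S. \<phi> g = 1}" using qb by simp
  then have "eq_ae q f" unfolding exposes by simp
  with ne show False by simp
qed

text \<open>
  The triangle inequality must be an equality almost everywhere, since its integrated form is one. So
  \<open>g\<close> is pointwise a nonnegative multiple of \<open>f\<close>. This is expressed without
  division because \<open>f\<close> may vanish.
\<close>

lemma convex_combination_norm_eq:
  assumes int: "integrable lborel f" "integrable lborel g" "integrable lborel h"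
    and norms: "norm1 f = 1" "norm1 g \<le> 1" "norm1 h \<le> 1"
    and t: "0 < t" "t < 1" and eq: "eq_ae f (\<lambda>x. (1 - t) *\<^sub>R g x + t *\<^sub>R h x)"
  shows "AE x in lborel. g x * of_real (norm (f x)) = of_real (norm (g x)) * f x
    \<and> (1 - t) * norm (g x) \<le> norm (f x)" and "norm1 g = 1"
proof -
  let ?e = "\<lambda>x. (1 - t) * norm (g x) + t * norm (h x) - norm (f x)"
  have le: "AE x in lborel. 0 \<le> ?e x"
    using eq unfolding eq_ae_def
  proof eventually_elim
    case (elim x)
    show ?case
      using norm_triangle_ineq[of "(1 - t) *\<^sub>R g x" "t *\<^sub>R h x"] t by (simp add: elim)
  qed
  have I: "(LINT x|lborel. ?e x) = (1 - t) * norm1 g + t * norm1 h - 1"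
    using int norms(1) by (simp add: norm1_def)
  have a: "(1 - t) * norm1 g \<le> (1 - t) * 1" "t * norm1 h \<le> t * 1"
    using norms t by (intro mult_left_mono; simp)+
  have "(LINT x|lborel. ?e x) \<ge> 0" by (rule integral_nonneg_AE[OF le])
  with I have ge: "(1 - t) * norm1 g + t * norm1 h - 1 \<ge> 0" by (simp only:)
  have 1: "(1 - t) * 1 + t * 1 = 1" by simp
  have 0: "(LINT x|lborel. ?e x) = 0" unfolding I using a ge 1 by linarith
  have "(1 - t) * norm1 g = (1 - t) * 1" using a ge 1 by linarith
  then show "norm1 g = 1" using t by simp
  have "AE x in lborel. ?e x = 0"
    using 0 le int by (subst (asm) integral_nonneg_eq_0_iff_AE) auto
  with eq[unfolded eq_ae_def] show "AE x in lborel. g x * of_real (norm (f x)) = of_real (norm (g x)) * f x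
    \<and> (1 - t) * norm (g x) \<le> norm (f x)"
  proof eventually_elim
    case (elim x)
    let ?A = "(1 - t) *\<^sub>R g x" and ?B = "t *\<^sub>R h x"
    have nA: "norm ?A = (1 - t) * norm (g x)" "norm ?B = t * norm (h x)" using t by auto
    have sum: "norm (?A + ?B) = norm ?A + norm ?B" using elim unfolding nA by simp
    then have "norm ?A *\<^sub>R ?B = norm ?B *\<^sub>R ?A" by (simp only: norm_triangle_eq)
    then have "(norm ?A + norm ?B) *\<^sub>R ?A = norm ?A *\<^sub>R (?A + ?B)"
      by (simp only: scaleR_add_left scaleR_add_right)
    then have "norm (f x) *\<^sub>R ?A = norm ?A *\<^sub>R f x"
      using elim(1) sum by simp
    then have "(1 - t) *\<^sub>R (norm (f x) *\<^sub>R g x) = (1 - t) *\<^sub>R (norm (g x) *\<^sub>R f x)"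
      unfolding nA by (simp add: mult_ac)
    then have "norm (f x) *\<^sub>R g x = norm (g x) *\<^sub>R f x" using t by (subst (asm) scaleR_cancel_left) auto
    moreover have "(1 - t) * norm (g x) \<le> norm (f x)"
    proof -
      have "0 \<le> t * norm (h x)" using t by (intro mult_nonneg_nonneg) auto
      with elim(2) show ?thesis by linarith
    qed
    ultimately show ?case by (simp add: scaleR_conv_of_real mult.commute)
  qed
qed

section \<open>Entire functions bounded off a line\<close>

lemma entire_eq_polynomial:
  assumes "h holomorphic_on UNIV" and "\<And>n. n > m \<Longrightarrow> (deriv ^^ n) h 0 = 0"
  shows "h z = (\<Sum>n\<le>m. (deriv ^^ n) h 0 / fact n * z ^ n)"
proof -
  have "(\<lambda>n. (deriv ^^ n) h 0 / fact n * (z - 0) ^ n) sums h z"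
    by (rule holomorphic_power_series[where r = "norm z + 1"])
       (auto intro: holomorphic_on_subset[OF assms(1)])
  moreover have "(\<lambda>n. (deriv ^^ n) h 0 / fact n * (z - 0) ^ n) sums
      (\<Sum>n\<le>m. (deriv ^^ n) h 0 / fact n * (z - 0) ^ n)"
    by (rule sums_finite) (auto simp: assms(2) not_le)
  ultimately show ?thesis
    using sums_unique2 by force
qed

text \<open>
  On the circle \<open>\<bar>z\<bar> = R\<close> the modulus of \<open>(d z)\<^sup>2 - R\<^sup>2\<close> is \<open>2 R \<bar>Im (d z)\<bar>\<close>. Multiplication by its \<open>k\<close>-th power
  therefore absorbs the factor \<open>\<bar>Im (d z)\<bar>\<^sup>k\<close> in the hypothesis, and by the maximum principle \<open>h\<close> grows at
  most like \<open>\<bar>z\<bar>\<^sup>m\<close>. The unimodular \<open>d\<close> allows for any line through the origin.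
\<close>

lemma higher_deriv_eq_0_if_bounded_off_line:
  fixes h :: "complex \<Rightarrow> complex"
  assumes hol: "h holomorphic_on UNIV" and d: "norm d = 1" and "m < n"
    and bd: "\<And>z. norm (h z) * \<bar>Im (d * z)\<bar> ^ k \<le> C * (1 + norm z) ^ (m + k)"
  shows "(deriv ^^ n) h 0 = 0"
proof -
  have C: "C \<ge> 0"
  proof -
    have "0 \<le> norm (h 0) * \<bar>Im (d * 0)\<bar> ^ k" by simp
    also have "\<dots> \<le> C" using bd[of 0] by simp
    finally show ?thesis .
  qed
  define K where "K = C * 3 ^ (m + k) * 2 ^ k"
  have K: "norm (h z) \<le> K * norm z ^ m" if z: "norm z \<ge> 1" for z
  proof -
    define R where "R = 2 * norm z"
    define q where "q = (\<lambda>w. h w * ((d * w)\<^sup>2 - of_real (R\<^sup>2)) ^ k)"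
    have q: "norm (q w) \<le> C * (1 + R) ^ (m + k) * (2 * R) ^ k" if "norm w = R" for w
    proof -
      \<comment> \<open>On the circle \<open>R\<^sup>2 = (d w) cnj (d w)\<close>, so the difference has a factor \<open>d w - cnj (d w)\<close>.\<close>
      have "of_real (R\<^sup>2) = (d * w) * cnj (d * w)"
        using that d by (simp only: complex_norm_square[symmetric]) (simp add: norm_mult)
      then have "(d * w)\<^sup>2 - of_real (R\<^sup>2) = (d * w) * ((d * w) - cnj (d * w))"
        by (simp add: power2_eq_square algebra_simps)
      also have "(d * w) - cnj (d * w) = 2 * \<i> * of_real (Im (d * w))"
        by (simp add: complex_eq_iff)
      finally have "norm ((d * w)\<^sup>2 - of_real (R\<^sup>2)) = norm (d * w) * norm (2 * \<i> * of_real (Im (d * w)))"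
        by (simp only: norm_mult)
      then have "norm ((d * w)\<^sup>2 - of_real (R\<^sup>2)) = 2 * R * \<bar>Im (d * w)\<bar>"
        using that d by (simp only: norm_mult norm_of_real norm_numeral norm_ii)
      then have "norm (q w) = norm (h w) * \<bar>Im (d * w)\<bar> ^ k * (2 * R) ^ k"
        by (simp only: q_def norm_mult norm_power) (simp add: power_mult_distrib)
      also have "\<dots> \<le> C * (1 + norm w) ^ (m + k) * (2 * R) ^ k"
        by (intro mult_right_mono bd) (use z R_def in auto)
      finally show ?thesis using that by simp
    qed
    have "norm (q z) \<le> C * (1 + R) ^ (m + k) * (2 * R) ^ k"
    proof (rule maximum_modulus_frontier[of q "cball 0 R"])
      show "q holomorphic_on interior (cball 0 R)" "continuous_on (closure (cball 0 R)) q"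
        unfolding q_def
        by (intro holomorphic_intros holomorphic_on_imp_continuous_on holomorphic_on_subset[OF hol], simp)+
      show "z \<in> cball 0 R" using z by (simp add: R_def)
      show "norm (q w) \<le> C * (1 + R) ^ (m + k) * (2 * R) ^ k" if "w \<in> frontier (cball 0 R)" for w
        using that z by (intro q) (auto simp: R_def)
    qed auto
    also have "\<dots> \<le> C * (3 * norm z) ^ (m + k) * (4 * norm z) ^ k"
    proof -
      have "(1 + R) ^ (m + k) \<le> (3 * norm z) ^ (m + k)"
        using z by (intro power_mono) (auto simp: R_def)
      then have "C * (1 + R) ^ (m + k) \<le> C * (3 * norm z) ^ (m + k)"
        by (intro mult_left_mono C)
      then show ?thesis
        by (simp add: R_def mult_right_mono)
    qed
    finally have 1: "norm (q z) \<le> C * (3 * norm z) ^ (m + k) * (4 * norm z) ^ k" .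
    have "2 * (norm z)\<^sup>2 \<le> R\<^sup>2 - (norm z)\<^sup>2" by (simp add: R_def power2_eq_square)
    also have "\<dots> = norm (of_real (R\<^sup>2) :: complex) - norm ((d * z)\<^sup>2)"
      using d by (simp add: norm_mult norm_power)
    also have "\<dots> \<le> norm ((d * z)\<^sup>2 - of_real (R\<^sup>2))"
      by (metis norm_minus_commute norm_triangle_ineq2)
    finally have "norm (h z) * (2 * (norm z)\<^sup>2) ^ k \<le> norm (q z)"
      unfolding q_def norm_mult norm_power by (intro mult_left_mono power_mono) auto
    with 1 have "norm (h z) * (2 * (norm z)\<^sup>2) ^ k \<le> C * (3 * norm z) ^ (m + k) * (4 * norm z) ^ k"
      by linarith
    also have "\<dots> = K * norm z ^ m * (2 * (norm z)\<^sup>2) ^ k"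
    proof -
      have sq: "4 * norm z * norm z = 2 * (2 * (norm z)\<^sup>2)"
        by (simp add: power2_eq_square)
      have "(4 * norm z) ^ k * (norm z) ^ k = 2 ^ k * (2 * (norm z)\<^sup>2) ^ k"
        by (simp only: power_mult_distrib[symmetric] sq)
      then have "C * 3 ^ (m + k) * norm z ^ m * ((4 * norm z) ^ k * (norm z) ^ k)
          = C * 3 ^ (m + k) * norm z ^ m * (2 ^ k * (2 * (norm z)\<^sup>2) ^ k)"
        by (rule arg_cong)
      moreover have "(3 * norm z) ^ (m + k) = 3 ^ (m + k) * (norm z ^ m * norm z ^ k)"
        by (simp add: power_mult_distrib power_add)
      ultimately show ?thesis
        by (simp only: K_def mult_ac)
    qed
    finally have "norm (h z) * (2 * (norm z)\<^sup>2) ^ k \<le> K * norm z ^ m * (2 * (norm z)\<^sup>2) ^ k" .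
    moreover have "0 < 2 * (norm z)\<^sup>2"
      using z by auto
    ultimately show ?thesis
      by (meson mult_right_le_imp_le zero_less_power)
  qed
  have bound: "norm ((deriv ^^ n) h 0) \<le> fact n * K / r" if r: "r \<ge> 1" for r
  proof -
    have "norm ((deriv ^^ n) h 0) \<le> fact n * (K * r ^ m) / r ^ n"
    proof (rule Cauchy_inequality[of h 0 r])
      show "h holomorphic_on ball 0 r" "continuous_on (cball 0 r) h"
        by (intro holomorphic_on_imp_continuous_on holomorphic_on_subset[OF hol], simp)+
      show "norm (h x) \<le> K * r ^ m" if "norm (0 - x) = r" for x
        using K[of x] that r by simp
    qed (use r in simp)
    also have "\<dots> = fact n * K / r ^ (n - m)"
      using \<open>m < n\<close> r by (simp add: power_diff field_simps)
    also have "\<dots> \<le> fact n * K / r"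
      using r \<open>m < n\<close> C by (intro divide_left_mono) (auto simp: K_def self_le_power)
    finally show ?thesis .
  qed
  have "eventually (\<lambda>r. norm ((deriv ^^ n) h 0) \<le> fact n * K / r) at_top"
    by (rule eventually_mono[OF eventually_ge_at_top[of 1]]) (rule bound)
  moreover have "((\<lambda>r. fact n * K / r) \<longlongrightarrow> 0) at_top"
    by (intro tendsto_divide_0[OF tendsto_const] filterlim_at_top_imp_at_infinity filterlim_ident)
  ultimately have "norm ((deriv ^^ n) h 0) \<le> 0"
    by (intro tendsto_lowerbound[where F = at_top]) (auto simp: trivial_limit_at_top_linorder)
  then show ?thesis by simp
qed

section \<open>Quotients that are real and bounded on the real line\<close>

lemma holomorphic_reflect:
  assumes "f holomorphic_on UNIV" shows "(\<lambda>z. cnj (f (cnj z))) holomorphic_on UNIV"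
proof -
  have "cnj ` UNIV = UNIV" by (simp add: image_cnj_conv_vimage_cnj)
  then show ?thesis
    using holomorphic_on_compose_cnj_cnj[of f UNIV] assms by (simp add: o_def)
qed

lemma filterlim_of_real_at_complex: "filterlim complex_of_real (at (of_real x)) (at x)"
  by (intro filterlim_atI) (auto intro!: tendsto_intros simp: eventually_at_filter)

lemma entire_eq_if_eq_on_reals:
  assumes f: "f holomorphic_on UNIV" and g: "g holomorphic_on UNIV"
    and eq: "\<And>x::real. f (of_real x) = g (of_real x)"
  shows "f z = g z"
proof -
  have "(\<lambda>z. f z - g z) z = 0"
  proof (rule analytic_continuation[where f = "\<lambda>z. f z - g z" and S = UNIV and U = \<real> and \<xi> = 0])
    show "(\<lambda>z. f z - g z) holomorphic_on UNIV" by (intro holomorphic_intros f g)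
    have "(0::complex) islimpt \<real>"
      unfolding islimpt_approachable
    proof (intro allI impI)
      fix e :: real assume "e > 0"
      then show "\<exists>x\<in>\<real>. x \<noteq> 0 \<and> dist x (0::complex) < e"
        by (intro bexI[of _ "of_real (e / 2)"]) auto
    qed
    then show "(0::complex) islimpt \<real>" .
  qed (auto simp: Reals_def eq)
  then show ?thesis by simp
qed

text \<open>
  The quotient \<open>G / F\<close> can only have singularities at real zeros of \<open>F\<close>, and these are removable because it is
  bounded on the real line. Being real there, it takes conjugate values at conjugate points, so the bound in
  the lower half-plane carries over to the upper one. Thus it is a polynomial bounded on the real line.
\<close>

lemma quotient_constant_if_real_bounded:
  fixes F G :: "complex \<Rightarrow> complex"
  assumes F: "F holomorphic_on UNIV" and G: "G holomorphic_on UNIV"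
    and nz: "\<And>z. Im z \<noteq> 0 \<Longrightarrow> F z \<noteq> 0"
    and real: "\<And>x::real. G (of_real x) * cnj (F (of_real x)) \<in> \<real>"
    and le: "\<And>x::real. norm (G (of_real x)) \<le> M * norm (F (of_real x))"
    and lower: "\<And>z. Im z < 0 \<Longrightarrow> norm (G z) * \<bar>Im z\<bar> ^ k \<le> C * (1 + norm z) ^ (m + k) * norm (F z)"
    and k: "k > 0"
  shows "\<exists>\<kappa>. \<forall>z. G z = \<kappa> * F z"
proof -
  define h where "h = remove_sings (\<lambda>z. G z / F z)"
  have F': "F analytic_on {z}" and G': "G analytic_on {z}" for z
    using F G by (auto intro: holomorphic_on_imp_analytic_at)
  have ev: "eventually (\<lambda>w. F w \<noteq> 0) (at z)" for z
    using non_zero_neighbour_alt[OF F open_UNIV connected_UNIV, of z \<i>] nz[of \<i>] by (auto elim: eventually_mono)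
  have an: "(\<lambda>z. G z / F z) analytic_on {z}" if "F z \<noteq> 0" for z
    using that by (intro analytic_intros F' G') auto
  have h_eq: "h z = G z / F z" if "F z \<noteq> 0" for z
    unfolding h_def by (rule remove_sings_at_analytic[OF an[OF that]])
  have ev_le: "eventually (\<lambda>x. norm (G (of_real x) / F (of_real x)) \<le> M) (at x)" for x :: real
  proof -
    have "eventually (\<lambda>x. F (of_real x) \<noteq> 0) (at x)"
      using filterlim_of_real_at_complex[of x] ev[of "of_real x"] by (rule eventually_compose_filterlim[rotated])
    then show ?thesis
      by eventually_elim (use le in \<open>auto simp: norm_divide field_simps\<close>)
  qed
  have "h analytic_on {z}" for z
  proof -
    let ?q = "\<lambda>z. G z / F z"
    have iso: "isolated_singularity_at ?q z"
      by (rule isolated_singularity_at_divide)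
        (rule isolated_singularity_at_analytic not_essential_analytic F' G')+
    have ne: "not_essential ?q z"
      by (rule not_essential_divide)
        (rule isolated_singularity_at_analytic not_essential_analytic F' G')+
    have "\<not> is_pole ?q z"
    proof (cases "Im z = 0")
      case True
      then have z: "z = of_real (Re z)" by (simp add: complex_eq_iff)
      show ?thesis
      proof
        assume "is_pole ?q z"
        then have "filterlim ?q at_infinity (at (of_real (Re z)))"
          unfolding is_pole_def using z by simp
        then have "filterlim (\<lambda>x. ?q (of_real x)) at_infinity (at (Re z))"
          by (rule filterlim_compose[OF _ filterlim_of_real_at_complex])
        then have "eventually (\<lambda>x. M + 1 \<le> norm (?q (of_real x))) (at (Re z))"
          using filterlim_at_infinity_imp_norm_at_top[of "\<lambda>x. ?q (of_real x)" "at (Re z)"]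
          by (simp add: filterlim_at_top)
        with ev_le[of "Re z"] have "eventually (\<lambda>x. False) (at (Re z))"
          by eventually_elim auto
        then show False by simp
      qed
    next
      case False
      then show ?thesis by (intro analytic_at_imp_no_pole an nz)
    qed
    then show ?thesis
      unfolding h_def using ne iso unfolding not_essential_def by (blast intro: remove_sings_analytic_at)
  qed
  then have h: "h holomorphic_on UNIV"
    by (meson analytic_imp_holomorphic analytic_on_analytic_at)
  \<comment> \<open>Realness on the line in a form without quotients, extended by the identity theorem.\<close>
  have refl: "G z * cnj (F (cnj z)) = cnj (G (cnj z)) * F z" for z
  proof (rule entire_eq_if_eq_on_reals[of "\<lambda>z. G z * cnj (F (cnj z))" "\<lambda>z. cnj (G (cnj z)) * F z"])
    show "(\<lambda>z. G z * cnj (F (cnj z))) holomorphic_on UNIV" "(\<lambda>z. cnj (G (cnj z)) * F z) holomorphic_on UNIV"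
      by (intro holomorphic_intros holomorphic_reflect F G)+
    show "G (of_real x) * cnj (F (cnj (of_real x))) = cnj (G (cnj (of_real x))) * F (of_real x)" for x
      using real[of x] by (simp add: Reals_cnj_iff)
  qed
  have neg: "norm (h z) * \<bar>Im z\<bar> ^ k \<le> C * (1 + norm z) ^ (m + k)" if "Im z < 0" for z
  proof -
    have "F z \<noteq> 0" using nz that by auto
    then show ?thesis
      using lower[OF that] by (simp add: h_eq norm_divide field_simps)
  qed
  have C: "C * (1 + norm z) ^ (m + k) \<ge> 0" for z :: complex
  proof -
    have "0 \<le> C * (1 + norm (- \<i>)) ^ (m + k)"
      by (rule order_trans[OF _ neg[of "- \<i>"]]) auto
    then have "C \<ge> 0" by (simp add: zero_le_mult_iff) (smt (verit) zero_less_power)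
    then show ?thesis by simp
  qed
  have bound: "norm (h z) * \<bar>Im (1 * z)\<bar> ^ k \<le> C * (1 + norm z) ^ (m + k)" for z
  proof -
    consider "Im z < 0" | "Im z = 0" | "Im z > 0" by linarith
    then show ?thesis
    proof cases
      case 3
      then have F0: "F z \<noteq> 0" "F (cnj z) \<noteq> 0" using nz[of z] nz[of "cnj z"] by auto
      have "h z = cnj (h (cnj z))"
        using refl[of z] F0 by (simp add: h_eq field_simps)
      then have "norm (h z) = norm (h (cnj z))" by (metis complex_mod_cnj)
      then show ?thesis using neg[of "cnj z"] 3 by simp
    next
      case 1
      then show ?thesis using neg by simp
    next
      case 2
      then show ?thesis using C[of z] k by (simp add: power_0_left)
    qed
  qed
  have poly: "h z = (\<Sum>n\<le>m. (deriv ^^ n) h 0 / fact n * z ^ n)" for z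
    by (rule entire_eq_polynomial[OF h higher_deriv_eq_0_if_bounded_off_line[OF h _ _ bound]]) auto
  have real_le: "norm (h (of_real x)) \<le> M" for x :: real
  proof (rule tendsto_upperbound)
    have "isCont h (of_real x)"
      using holomorphic_on_imp_continuous_on[OF h] by (simp add: continuous_on_eq_continuous_at)
    then show "((\<lambda>y. norm (h (of_real y))) \<longlongrightarrow> norm (h (of_real x))) (at x)"
      by (intro tendsto_norm isCont_tendsto_compose[where g = h]) (auto intro!: tendsto_intros)
    have "eventually (\<lambda>x. F (of_real x) \<noteq> 0) (at x)"
      using filterlim_of_real_at_complex[of x] ev[of "of_real x"] by (rule eventually_compose_filterlim[rotated])
    with ev_le[of x] show "eventually (\<lambda>y. norm (h (of_real y)) \<le> M) (at x)"
      by eventually_elim (simp add: h_eq)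
  qed simp
  have zero: "(deriv ^^ n) h 0 / fact n = 0" if n: "1 \<le> n" "n \<le> m" for n
  proof (rule ccontr)
    assume "(deriv ^^ n) h 0 / fact n \<noteq> 0"
    then have "eventually (\<lambda>z. norm (\<Sum>n\<le>m. (deriv ^^ n) h 0 / fact n * z ^ n) \<ge> M + 1) at_infinity"
      by (intro polyfun_extremal exI[of _ n]) (use n in auto)
    then have "eventually (\<lambda>z. norm (h z) \<ge> M + 1) at_infinity"
      by (simp only: poly[symmetric])
    then obtain b where b: "\<And>z. norm z \<ge> b \<Longrightarrow> norm (h z) \<ge> M + 1"
      unfolding eventually_at_infinity by blast
    have "norm (h (of_real \<bar>b\<bar>)) \<ge> M + 1" by (rule b) simp
    with real_le[of "\<bar>b\<bar>"] show False by linarith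
  qed
  have const: "h z = h 0" for z
  proof -
    \<comment> \<open>Only the constant term of the polynomial remains.\<close>
    have "h z = (\<Sum>n\<in>{0}. (deriv ^^ n) h 0 / fact n * z ^ n)"
      unfolding poly[of z] by (rule sum.mono_neutral_right) (use zero in auto)
    then show ?thesis by simp
  qed
  have "G z = h 0 * F z" for z
  proof -
    have "(\<lambda>z. G z - h 0 * F z) z = 0"
    proof (rule analytic_continuation_open[where f = "\<lambda>z. G z - h 0 * F z" and g = "\<lambda>_. 0" and s = "{z. Im z > 0}" and s' = UNIV])
      show "open {z. Im z > 0}" by (rule open_halfspace_Im_gt)
      show "{z. Im z > 0} \<noteq> {}" by (auto intro: exI[of _ \<i>])
      show "(\<lambda>z. G z - h 0 * F z) holomorphic_on UNIV" by (intro holomorphic_intros F G)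
      show "G z - h 0 * F z = 0" if "z \<in> {z. Im z > 0}" for z
        using const[of z] h_eq[of z] nz[of z] that by auto
    qed auto
    then show ?thesis by simp
  qed
  then show ?thesis by blast
qed

section \<open>Entire functions of type zero integrable against an exponential sum\<close>

definition of_type_0 :: "(complex \<Rightarrow> complex) \<Rightarrow> bool" where
  "of_type_0 w \<longleftrightarrow> w holomorphic_on UNIV \<and> (\<forall>\<epsilon>>0. \<exists>C. \<forall>z. norm (w z) \<le> C * exp (\<epsilon> * norm z))"

text \<open>
  In terms of the Taylor coefficients \<open>w\<^sub>n\<close> of \<open>w\<close> this is \<open>\<Sum> n! w\<^sub>n u\<^sup>n\<close>. It converges everywhere if \<open>w\<close> is of type zero, and then \<open>deriv_gf w (1 / s) / s\<close> is the Borel transform of \<open>w\<close>.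
\<close>

definition deriv_gf :: "(complex \<Rightarrow> complex) \<Rightarrow> complex \<Rightarrow> complex" where
  "deriv_gf w u = (\<Sum>n. (deriv ^^ n) w 0 * u ^ n)"

text \<open>
  Cauchy's inequality on the circle of radius \<open>n / \<epsilon>\<close>, which optimizes \<open>exp (\<epsilon> r) / r\<^sup>n\<close>, and \<open>n! \<le> n\<^sup>n\<close>.
\<close>

lemma of_type_0_deriv_bound:
  assumes w: "of_type_0 w" and q: "q > 0"
  obtains K where "\<And>n. norm ((deriv ^^ n) w 0) \<le> K * q ^ n"
proof -
  define \<epsilon> where "\<epsilon> = q / exp 1"
  have \<epsilon>: "\<epsilon> > 0" using q by (simp add: \<epsilon>_def)
  then obtain C where C: "\<And>z. norm (w z) \<le> C * exp (\<epsilon> * norm z)"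
    using w by (auto simp: of_type_0_def)
  have hol: "w holomorphic_on UNIV" using w by (simp add: of_type_0_def)
  have "C \<ge> norm (w 0)" using C[of 0] by simp
  then have C0: "C \<ge> 0" by (rule order_trans[OF norm_ge_zero])
  have "norm ((deriv ^^ n) w 0) \<le> C * q ^ n" for n
  proof (cases "n = 0")
    case False
    define r where "r = n / \<epsilon>"
    have r: "r > 0" using False \<epsilon> by (simp add: r_def)
    have "norm ((deriv ^^ n) w 0) \<le> fact n * (C * exp (\<epsilon> * r)) / r ^ n"
    proof (rule Cauchy_inequality[of w 0 r])
      show "w holomorphic_on ball 0 r" "continuous_on (cball 0 r) w"
        by (intro holomorphic_on_imp_continuous_on holomorphic_on_subset[OF hol], simp)+
      show "norm (w x) \<le> C * exp (\<epsilon> * r)" if "norm (0 - x) = r" for x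
        using C[of x] that by simp
    qed (rule r)
    also have "exp (\<epsilon> * r) = exp 1 ^ n"
      using \<epsilon> by (simp add: r_def flip: exp_of_nat_mult)
    also have "fact n * (C * exp 1 ^ n) / r ^ n \<le> real n ^ n * (C * exp 1 ^ n) / r ^ n"
    proof (intro divide_right_mono mult_right_mono)
      show "fact n \<le> real n ^ n"
        using fact_le_power[of n, where 'a = real] by simp
    qed (use C0 r in auto)
    also have "\<dots> = C * q ^ n"
      using False q by (simp add: r_def \<epsilon>_def power_divide power_mult_distrib)
    finally show ?thesis .
  qed (use C[of 0] in simp)
  then show ?thesis by (rule that)
qed

lemma summable_norm_deriv_gf:
  assumes w: "of_type_0 w"
  shows "summable (\<lambda>n. norm ((deriv ^^ n) w 0) * r ^ n)"
proof -
  \<comment> \<open>A ratio \<open>q\<close> that makes the series comparable to a geometric series with ratio \<open>1 / 2\<close>.\<close>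
  define q where "q = 1 / (2 * (\<bar>r\<bar> + 1))"
  have q: "q > 0" "q * \<bar>r\<bar> \<le> 1 / 2" by (auto simp: q_def field_simps)
  obtain K where K: "\<And>n. norm ((deriv ^^ n) w 0) \<le> K * q ^ n"
    using of_type_0_deriv_bound[OF w q(1)] by blast
  have K0: "K \<ge> 0" using order_trans[OF norm_ge_zero K[of 0]] by simp
  show ?thesis
  proof (rule summable_comparison_test', rule summable_mult, rule summable_geometric)
    fix n
    have "norm (norm ((deriv ^^ n) w 0) * r ^ n) \<le> K * q ^ n * \<bar>r\<bar> ^ n"
      using K[of n] by (simp add: abs_mult power_abs mult_right_mono)
    also have "\<dots> = K * (q * \<bar>r\<bar>) ^ n" by (simp add: power_mult_distrib)
    also have "\<dots> \<le> K * (1 / 2) ^ n"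
      using q K0 by (intro mult_left_mono power_mono) auto
    finally show "norm (norm ((deriv ^^ n) w 0) * r ^ n) \<le> K * (1 / 2) ^ n" .
  qed simp
qed

lemma deriv_gf_sums:
  assumes "of_type_0 w" shows "(\<lambda>n. (deriv ^^ n) w 0 * u ^ n) sums deriv_gf w u"
proof -
  have "summable (\<lambda>n. norm ((deriv ^^ n) w 0 * u ^ n))"
    using summable_norm_deriv_gf[OF assms, of "norm u"] by (simp add: norm_mult norm_power)
  then show ?thesis
    unfolding deriv_gf_def by (rule summable_sums[OF summable_norm_cancel])
qed

lemma deriv_gf_holomorphic:
  assumes "of_type_0 w" shows "deriv_gf w holomorphic_on UNIV"
proof (rule holomorphic_on_subset)
  have "deriv_gf w holomorphic_on ball 0 r" for r
    by (rule power_series_holomorphic[where a = "\<lambda>n. (deriv ^^ n) w 0"])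
      (simp add: deriv_gf_sums[OF assms])
  then show "deriv_gf w holomorphic_on (\<Union>r. ball 0 r)"
    by (intro holomorphic_on_UN_open) auto
  show "UNIV \<subseteq> (\<Union>r. ball (0::complex) r)"
    using gt_ex by auto
qed

lemma higher_deriv_deriv_gf:
  assumes "of_type_0 w" shows "(deriv ^^ n) (deriv_gf w) 0 = fact n * (deriv ^^ n) w 0"
proof -
  have "deriv_gf w has_fps_expansion Abs_fps (\<lambda>n. (deriv ^^ n) w 0)"
    by (rule has_fps_expansionI) (simp add: deriv_gf_sums[OF assms])
  from fps_nth_fps_expansion[OF this, of n] show ?thesis by simp
qed

lemma power_exp_integral_real:
  assumes "r > 0"
  shows "integrable lborel (\<lambda>x. indicator {0<..} x * (x ^ n * exp (- r * x)) :: real)"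
    and "(LINT x|lborel. indicator {0<..} x * (x ^ n * exp (- r * x))) = fact n / r ^ Suc n"
proof -
  have "(\<integral>\<^sup>+x. ennreal (indicator {0<..} x * (x ^ n * exp (- r * x))) \<partial>lborel)
      = (\<integral>\<^sup>+x. ennreal (1 / r) * ennreal (erlang_density 0 r x * x ^ n) \<partial>lborel)"
  proof (rule nn_integral_cong_AE)
    have "AE x in lborel. x \<noteq> (0::real)" by (rule AE_lborel_singleton)
    then show "AE x in lborel. ennreal (indicator {0<..} x * (x ^ n * exp (- r * x)))
        = ennreal (1 / r) * ennreal (erlang_density 0 r x * x ^ n)"
      by eventually_elim
        (use assms in \<open>auto simp: erlang_density_def indicator_def ennreal_mult'[symmetric]\<close>)
  qed
  also have "\<dots> = ennreal (1 / r) * ennreal (fact n / r ^ n)"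
    using nn_integral_erlang_ith_moment[OF assms, of 0 n] by (subst nn_integral_cmult) auto
  also have "\<dots> = ennreal (fact n / r ^ Suc n)"
    using assms by (simp flip: ennreal_mult')
  finally have *: "(\<integral>\<^sup>+x. ennreal (indicator {0<..} x * (x ^ n * exp (- r * x))) \<partial>lborel)
      = ennreal (fact n / r ^ Suc n)" .
  have "has_bochner_integral lborel (\<lambda>x. indicator {0<..} x * (x ^ n * exp (- r * x))) (fact n / r ^ Suc n)"
    by (rule has_bochner_integral_nn_integral[OF _ _ _ *])
      (use assms in \<open>auto simp: indicator_def\<close>)
  then show "integrable lborel (\<lambda>x. indicator {0<..} x * (x ^ n * exp (- r * x)) :: real)"
    "(LINT x|lborel. indicator {0<..} x * (x ^ n * exp (- r * x))) = fact n / r ^ Suc n"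
    by (auto simp: has_bochner_integral_iff)
qed

lemma set_integrable_power_exp:
  assumes "Re s > 0"
  shows "set_integrable lborel {0<..} (\<lambda>x. complex_of_real x ^ n * exp (- s * of_real x))"
  unfolding set_integrable_def
  by (rule Bochner_Integration.integrable_bound[OF power_exp_integral_real(1)[OF assms, of n]])
    (auto simp: norm_mult norm_power indicator_def)

text \<open>
  The integral of the derivative of \<open>x\<^sup>n exp (- s x)\<close> over the half-line relates consecutive values of \<open>n\<close>.
\<close>

lemma power_exp_integral:
  assumes s: "Re s > 0"
  shows "(LINT x:{0<..}|lborel. complex_of_real x ^ n * exp (- s * of_real x)) = fact n / s ^ Suc n"
proof -
  define J where "J = (\<lambda>n. LINT x:{0<..}|lborel. complex_of_real x ^ n * exp (- s * of_real x))"
  have s0: "s \<noteq> 0" using s by auto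
  have rec: "of_nat n * J (n - 1) - s * J n = - (0 ^ n)" for n
  proof -
    let ?f = "\<lambda>x::real. of_nat n * (complex_of_real x ^ (n - 1) * exp (- s * of_real x))
      - s * (complex_of_real x ^ n * exp (- s * of_real x))"
    have int: "set_integrable lborel {0<..} ?f"
      by (intro set_integral_diff set_integrable_mult_right set_integrable_power_exp s)
    have "(LBINT x=ereal 0..\<infinity>. ?f x) = 0 - 0 ^ n"
    proof (rule interval_integral_FTC_integrable[where F = "\<lambda>x. complex_of_real x ^ n * exp (- s * of_real x)"])
      fix x :: real
      have "((\<lambda>z. z ^ n * exp (- s * z)) has_field_derivative ?f x) (at (of_real x))"
        by (auto intro!: derivative_eq_intros)
      then show "((\<lambda>x. complex_of_real x ^ n * exp (- s * of_real x)) has_vector_derivative ?f x) (at x)"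
        by (auto dest!: has_vector_derivative_real_field)
      show "isCont ?f x" by (intro continuous_intros)
    next
      show "set_integrable lborel (einterval (ereal 0) \<infinity>) ?f"
        using int by (simp add: einterval_eq)
      have "((\<lambda>x. complex_of_real x ^ n * exp (- s * of_real x)) \<longlongrightarrow> of_real 0 ^ n * exp (- s * of_real 0)) (at_right 0)"
        by (intro tendsto_intros)
      then show "(((\<lambda>x. complex_of_real x ^ n * exp (- s * of_real x)) \<circ> real_of_ereal) \<longlongrightarrow> 0 ^ n) (at_right (ereal 0))"
        by (simp add: ereal_tendsto_simps)
      have "((\<lambda>x::real. x ^ n * exp (- Re s * x)) \<longlongrightarrow> 0) at_top"
        using s by real_asymp
      then have "((\<lambda>x. complex_of_real x ^ n * exp (- s * of_real x)) \<longlongrightarrow> 0) at_top"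
        by (rule Lim_null_comparison[rotated])
          (auto simp: norm_mult norm_power intro!: eventually_mono[OF eventually_ge_at_top[of 0]])
      then show "(((\<lambda>x. complex_of_real x ^ n * exp (- s * of_real x)) \<circ> real_of_ereal) \<longlongrightarrow> 0) (at_left \<infinity>)"
        by (simp add: ereal_tendsto_simps)
    qed simp
    moreover have "(LBINT x=ereal 0..\<infinity>. ?f x) = of_nat n * J (n - 1) - s * J n"
      unfolding J_def interval_integral_to_infinity_eq
      by (subst set_integral_diff)
        (intro set_integrable_mult_right set_integrable_power_exp s | simp)+
    ultimately show ?thesis by simp
  qed
  have "J n = fact n / s ^ Suc n"
  proof (induction n)
    case 0
    show ?case using rec[of 0] s0 by (simp add: field_simps)
  next
    case (Suc n)
    have "s * J (Suc n) = of_nat (Suc n) * J n" using rec[of "Suc n"] by simp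
    then show ?case using Suc s0 by (simp add: field_simps)
  qed
  then show ?thesis by (simp only: J_def)
qed

definition borel_transform :: "(complex \<Rightarrow> complex) \<Rightarrow> complex \<Rightarrow> complex" where
  "borel_transform w s = deriv_gf w (1 / s) / s"

text \<open>
  Termwise integration of the Taylor series, justified by \<open>summable_norm_deriv_gf\<close> at \<open>1 / Re s\<close>.
\<close>

lemma laplace_eq_borel_transform:
  assumes w: "of_type_0 w" and s: "Re s > 0"
  shows "set_integrable lborel {0<..} (\<lambda>x. w (of_real x) * exp (- s * of_real x))"
    and "(LINT x:{0<..}|lborel. w (of_real x) * exp (- s * of_real x)) = borel_transform w s"
proof -
  let ?b = "\<lambda>n. (deriv ^^ n) w 0"
  define f where "f = (\<lambda>n x. indicator {0<..} x *\<^sub>R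
    (?b n / fact n * (complex_of_real x ^ n * exp (- s * of_real x))))"
  have hol: "w holomorphic_on UNIV" using w by (simp add: of_type_0_def)
  have s0: "s \<noteq> 0" using s by auto
  have f: "integrable lborel (f n)" for n
    unfolding f_def using set_integrable_mult_right[OF set_integrable_power_exp[OF s, of n], of "?b n / fact n"]
    by (simp add: set_integrable_def)
  have norm_f: "norm (f n x) = norm (?b n) / fact n * (indicator {0<..} x * (x ^ n * exp (- Re s * x)))" for n x
    by (simp add: f_def norm_mult norm_divide norm_power indicator_def)
  have w_sums: "(\<lambda>n. ?b n / fact n * z ^ n) sums w z" for z
    using holomorphic_power_series[of w 0 "norm z + 1" z] holomorphic_on_subset[OF hol] by simp
  have f_sums: "(\<lambda>n. f n x) sums (indicator {0<..} x *\<^sub>R (w (of_real x) * exp (- s * of_real x)))" for x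
    using sums_scaleR_right[OF sums_mult2[OF w_sums[of "of_real x"], of "exp (- s * of_real x)"], of "indicator {0<..} x"]
    by (simp only: f_def mult.assoc)
  have 1: "summable (\<lambda>n. norm (f n x))" for x
  proof (rule summable_comparison_test')
    show "summable (\<lambda>n. norm (?b n) * \<bar>x\<bar> ^ n)" by (rule summable_norm_deriv_gf[OF w])
    fix n
    show "norm (norm (f n x)) \<le> norm (?b n) * \<bar>x\<bar> ^ n"
    proof (cases "x > 0")
      case True
      have "norm (?b n) / fact n * (x ^ n * exp (- Re s * x)) \<le> norm (?b n) / 1 * (x ^ n * 1)"
        using True s by (intro mult_mono divide_left_mono) auto
      then show ?thesis using True by (simp add: norm_f)
    qed (simp add: norm_f)
  qed
  have 2: "(LINT x|lborel. norm (f n x)) = norm (?b n) * (1 / Re s) ^ n * (1 / Re s)" for n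
    unfolding norm_f using power_exp_integral_real(2)[OF s, of n] s
    by (simp add: power_divide)
  have 3: "summable (\<lambda>n. LINT x|lborel. norm (f n x))"
    unfolding 2 by (intro summable_mult2 summable_norm_deriv_gf[OF w])
  have "integrable lborel (\<lambda>x. \<Sum>n. f n x)"
    by (rule integrable_suminf[OF f AE_I2[OF 1] 3])
  then show "set_integrable lborel {0<..} (\<lambda>x. w (of_real x) * exp (- s * of_real x))"
    unfolding set_integrable_def sums_unique[OF f_sums] .
  have 4: "integral\<^sup>L lborel (f n) = ?b n * (1 / s) ^ n / s" for n
  proof -
    have "integral\<^sup>L lborel (f n) = ?b n / fact n * (LINT x:{0<..}|lborel. complex_of_real x ^ n * exp (- s * of_real x))"
      unfolding f_def set_lebesgue_integral_def
      by (simp only: mult_scaleR_right[symmetric] integral_mult_right_zero)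
    then show ?thesis
      unfolding power_exp_integral[OF s] using s0 by (simp add: field_simps)
  qed
  have "(LINT x|lborel. (\<Sum>n. f n x)) = (\<Sum>n. integral\<^sup>L lborel (f n))"
    by (rule integral_suminf[OF f AE_I2[OF 1] 3])
  also have "\<dots> = (\<Sum>n. ?b n * (1 / s) ^ n / s)" by (simp only: 4)
  also have "\<dots> = borel_transform w s"
    unfolding borel_transform_def by (rule sums_unique[symmetric, OF sums_divide[OF deriv_gf_sums[OF w]]])
  finally show "(LINT x:{0<..}|lborel. w (of_real x) * exp (- s * of_real x)) = borel_transform w s"
    unfolding set_lebesgue_integral_def sums_unique[OF f_sums] .
qed

lemma sq_exp_le:
  fixes r x :: real
  assumes "r > 0" "x \<ge> 0"
  shows "(1 + x\<^sup>2) * exp (- r * x) \<le> 1 + 2 / r\<^sup>2"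
proof -
  have "(r * x)\<^sup>2 / 2 \<le> exp (r * x)"
    using exp_lower_Taylor_quadratic[of "r * x"] assms by (smt (verit) mult_nonneg_nonneg)
  then have "x\<^sup>2 \<le> 2 / r\<^sup>2 * exp (r * x)"
    using assms by (simp add: field_simps power_mult_distrib)
  moreover have "1 \<le> exp (r * x)" using assms by simp
  ultimately have "1 + x\<^sup>2 \<le> (1 + 2 / r\<^sup>2) * exp (r * x)"
    unfolding distrib_right by linarith
  then have "(1 + x\<^sup>2) * exp (- r * x) \<le> (1 + 2 / r\<^sup>2) * exp (r * x) * exp (- r * x)"
    by (intro mult_right_mono) auto
  also have "\<dots> = 1 + 2 / r\<^sup>2" by (simp add: mult.assoc flip: exp_add)
  finally show ?thesis .
qed

text \<open>
  The term with frequency \<open>0\<close> and coefficient \<open>1\<close> singles out one term of a general exponential sum,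
  which takes this form after multiplication by a constant and an exponential.
\<close>

definition exp_sum :: "'i set \<Rightarrow> ('i \<Rightarrow> complex) \<Rightarrow> ('i \<Rightarrow> real) \<Rightarrow> real \<Rightarrow> complex" where
  "exp_sum J c \<mu> x = 1 + (\<Sum>j\<in>J. c j * exp (\<i> * of_real (\<mu> j) * of_real x))"

text \<open>
  The combination of translates on the left is the Laplace transform of \<open>w\<close> times the exponential sum, and
  \<open>sq_exp_le\<close> compares \<open>exp (- Re s * x)\<close> with the weight \<open>1 / (1 + x\<^sup>2)\<close>.
\<close>

lemma borel_transform_shifts_bound:
  assumes w: "of_type_0 w" and J: "finite J"
    and int: "integrable lborel (\<lambda>x. w (of_real x) * exp_sum J c \<mu> x / of_real (1 + x\<^sup>2))"
    and s: "Re s > 0"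
  shows "norm (borel_transform w s + (\<Sum>j\<in>J. c j * borel_transform w (s - \<i> * of_real (\<mu> j))))
    \<le> (LINT x|lborel. norm (w (of_real x) * exp_sum J c \<mu> x / of_real (1 + x\<^sup>2))) * (1 + 2 / (Re s)\<^sup>2)"
proof -
  let ?T = "exp_sum J c \<mu>" and ?g = "\<lambda>x. w (of_real x) * exp_sum J c \<mu> x / of_real (1 + x\<^sup>2)"
  let ?s = "\<lambda>j. s - \<i> * of_real (\<mu> j)"
  have sj: "Re (?s j) > 0" for j using s by simp
  have eq: "w (of_real x) * ?T x * exp (- s * of_real x) = w (of_real x) * exp (- s * of_real x)
      + (\<Sum>j\<in>J. c j * (w (of_real x) * exp (- ?s j * of_real x)))" for x
  proof -
    have "exp (\<i> * of_real (\<mu> j) * of_real x) * exp (- s * of_real x) = exp (- ?s j * of_real x)" for j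
      by (simp add: algebra_simps flip: exp_add)
    then show ?thesis
      by (simp add: exp_sum_def distrib_left distrib_right sum_distrib_left sum_distrib_right mult_ac)
  qed
  have I: "set_integrable lborel {0<..} (\<lambda>x. c j * (w (of_real x) * exp (- ?s j * of_real x)))" for j
    by (intro set_integrable_mult_right laplace_eq_borel_transform(1) w sj)
  have S: "set_integrable lborel {0<..} (\<lambda>x. \<Sum>j\<in>J. c j * (w (of_real x) * exp (- ?s j * of_real x)))"
    using I unfolding set_integrable_def by (simp only: scaleR_sum_right) (intro Bochner_Integration.integrable_sum)
  have "(LINT x:{0<..}|lborel. w (of_real x) * ?T x * exp (- s * of_real x))
      = borel_transform w s + (\<Sum>j\<in>J. c j * borel_transform w (?s j))"
  proof -
    have "(LINT x:{0<..}|lborel. (\<Sum>j\<in>J. c j * (w (of_real x) * exp (- ?s j * of_real x))))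
        = (\<Sum>j\<in>J. LINT x:{0<..}|lborel. c j * (w (of_real x) * exp (- ?s j * of_real x)))"
      unfolding set_lebesgue_integral_def scaleR_sum_right
      by (rule Bochner_Integration.integral_sum) (use I in \<open>simp add: set_integrable_def\<close>)
    also have "\<dots> = (\<Sum>j\<in>J. c j * borel_transform w (?s j))"
      by (simp only: set_integral_mult_right laplace_eq_borel_transform(2)[OF w sj])
    finally show ?thesis
      unfolding eq
      by (subst set_integral_add(2)[OF laplace_eq_borel_transform(1)[OF w s] S])
        (simp only: laplace_eq_borel_transform(2)[OF w s])
  qed
  then have "borel_transform w s + (\<Sum>j\<in>J. c j * borel_transform w (?s j)) =
      (LINT x|lborel. indicator {0<..} x *\<^sub>R (w (of_real x) * ?T x * exp (- s * of_real x)))"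
    by (simp only: set_lebesgue_integral_def)
  then have "norm (borel_transform w s + (\<Sum>j\<in>J. c j * borel_transform w (?s j)))
      \<le> (LINT x|lborel. norm (indicator {0<..} x *\<^sub>R (w (of_real x) * ?T x * exp (- s * of_real x))))"
    by (simp only: integral_norm_bound)
  also have "\<dots> \<le> (LINT x|lborel. norm (?g x) * (1 + 2 / (Re s)\<^sup>2))"
  proof (rule integral_mono_AE')
    show "integrable lborel (\<lambda>x. norm (?g x) * (1 + 2 / (Re s)\<^sup>2))"
      using int by (intro integrable_mult_left integrable_norm)
    have "norm (indicator {0<..} x *\<^sub>R (w (of_real x) * ?T x * exp (- s * of_real x)))
        \<le> norm (?g x) * (1 + 2 / (Re s)\<^sup>2)" for x
    proof (cases "x > 0")
      case True
      have x2: "norm (complex_of_real (1 + x\<^sup>2)) = 1 + x\<^sup>2" "1 + x\<^sup>2 > 0"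
        unfolding norm_of_real by (auto simp: abs_of_nonneg add_pos_nonneg)
      have "norm (indicator {0<..} x *\<^sub>R (w (of_real x) * ?T x * exp (- s * of_real x)))
          = norm (?g x) * ((1 + x\<^sup>2) * exp (- Re s * x))"
        using True x2 by (simp add: norm_mult norm_divide del: of_real_add)
      also have "\<dots> \<le> norm (?g x) * (1 + 2 / (Re s)\<^sup>2)"
        using sq_exp_le[OF s, of x] True by (intro mult_left_mono) auto
      finally show ?thesis .
    qed (simp add: indicator_def)
    then show "AE x in lborel. norm (indicator {0<..} x *\<^sub>R (w (of_real x) * ?T x * exp (- s * of_real x)))
        \<le> norm (?g x) * (1 + 2 / (Re s)\<^sup>2)" by simp
  qed auto
  finally show ?thesis by simp
qed


lemma of_type_0_reflect:
  assumes w: "of_type_0 w"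
  shows "of_type_0 (\<lambda>z. w (- z))" and "borel_transform (\<lambda>z. w (- z)) (- s) = - borel_transform w s"
proof -
  have hol: "w holomorphic_on UNIV" using w by (simp add: of_type_0_def)
  have "(\<lambda>z. w (- z)) holomorphic_on UNIV"
    using holomorphic_on_compose[of uminus UNIV w] holomorphic_on_subset[OF hol]
    by (simp add: o_def holomorphic_on_minus)
  moreover have "\<exists>C. \<forall>z. norm (w (- z)) \<le> C * exp (e * norm z)" if "e > 0" for e
    using w that unfolding of_type_0_def by (metis norm_minus_cancel)
  ultimately show "of_type_0 (\<lambda>z. w (- z))" by (simp add: of_type_0_def)
  have "(deriv ^^ n) (\<lambda>z. w (- z)) 0 = (- 1) ^ n * (deriv ^^ n) w 0" for n
    using higher_deriv_compose_linear[OF hol, of UNIV 0 "- 1" n] by simp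
  then have "(deriv ^^ n) (\<lambda>z. w (- z)) 0 * (1 / (- s)) ^ n = (deriv ^^ n) w 0 * (1 / s) ^ n" for n
    by (cases "even n") (simp_all add: power_minus_odd power_divide)
  then have "deriv_gf (\<lambda>z. w (- z)) (1 / - s) = deriv_gf w (1 / s)"
    unfolding deriv_gf_def by (simp only:)
  then show "borel_transform (\<lambda>z. w (- z)) (- s) = - borel_transform w s"
    by (simp add: borel_transform_def)
qed

text \<open>
  In the left half-plane the Borel transform is minus the Laplace integral over the negative half-line;
  the reflection \<open>x \<mapsto> - x\<close> reduces this to the right half-plane.
\<close>

lemma borel_transform_shifts_bound_nonzero:
  assumes w: "of_type_0 w" and J: "finite J"
    and int: "integrable lborel (\<lambda>x. w (of_real x) * exp_sum J c \<mu> x / of_real (1 + x\<^sup>2))"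
    and s: "Re s \<noteq> 0"
  shows "norm (borel_transform w s + (\<Sum>j\<in>J. c j * borel_transform w (s - \<i> * of_real (\<mu> j))))
    \<le> (LINT x|lborel. norm (w (of_real x) * exp_sum J c \<mu> x / of_real (1 + x\<^sup>2))) * (1 + 2 / (Re s)\<^sup>2)"
proof (cases "Re s > 0")
  case False
  let ?g = "\<lambda>x. w (of_real x) * exp_sum J c \<mu> x / of_real (1 + x\<^sup>2)"
  let ?h = "\<lambda>x. w (- of_real x) * exp_sum J c (\<lambda>j. - \<mu> j) x / of_real (1 + x\<^sup>2)"
  have gh: "?h x = ?g (- x)" for x by (simp add: exp_sum_def)
  have "integrable lborel (\<lambda>x. ?g (0 + (- 1) * x))"
    by (rule lborel_integrable_real_affine[OF int]) simp
  then have int': "integrable lborel ?h" unfolding gh by simp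
  have refl: "(LINT x|lborel. norm (?h x)) = (LINT x|lborel. norm (?g x))"
    unfolding gh using lborel_integral_real_affine[of "- 1" "\<lambda>x. norm (?g x)" 0] by simp
  have "borel_transform (\<lambda>z. w (- z)) (- s - \<i> * of_real (- \<mu> j)) = - borel_transform w (s - \<i> * of_real (\<mu> j))" for j
    using of_type_0_reflect(2)[OF w, of "s - \<i> * of_real (\<mu> j)"] by simp
  then have "borel_transform (\<lambda>z. w (- z)) (- s)
      + (\<Sum>j\<in>J. c j * borel_transform (\<lambda>z. w (- z)) (- s - \<i> * of_real (- \<mu> j)))
    = - (borel_transform w s + (\<Sum>j\<in>J. c j * borel_transform w (s - \<i> * of_real (\<mu> j))))"
    by (simp only: of_type_0_reflect(2)[OF w] mult_minus_right sum_negf minus_add_distrib)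
  moreover have "Re (- s) > 0" using False s by simp
  ultimately show ?thesis
    using borel_transform_shifts_bound[OF of_type_0_reflect(1)[OF w] J int', of "- s"]
    unfolding refl by (simp only: norm_minus_cancel uminus_complex.sel power2_minus)
qed (rule borel_transform_shifts_bound[OF w J int])

text \<open>
  Near \<open>0\<close> the translated Borel transforms are bounded, since their singularities lie at the points
  \<open>\<i> \<mu> j \<noteq> 0\<close>. So the Borel transform itself is \<open>O((Re s)\<^sup>-\<^sup>2)\<close> there, however small the exponential sum may be on
  the real line. For \<open>u = 1 / s\<close> this is a bound off the imaginary axis for the entire function
  \<open>deriv_gf w\<close>, which forces all its coefficients of order greater than \<open>1\<close> to vanish.
\<close>

theorem affine_if_integrable_against_exp_sum:
  assumes w: "of_type_0 w" and J: "finite J" and \<mu>: "\<And>j. j \<in> J \<Longrightarrow> \<mu> j \<noteq> 0"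
    and int: "integrable lborel (\<lambda>x. w (of_real x) * exp_sum J c \<mu> x / of_real (1 + x\<^sup>2))"
  shows "\<exists>\<alpha> \<beta>. \<forall>z. w z = \<alpha> + \<beta> * z"
proof -
  let ?\<gamma> = "deriv_gf w" and ?L = "borel_transform w"
  have hol: "?\<gamma> holomorphic_on UNIV" by (rule deriv_gf_holomorphic[OF w])
  have whol: "w holomorphic_on UNIV" using w by (simp add: of_type_0_def)
  have cont: "continuous_on A ?\<gamma>" for A
    by (intro holomorphic_on_imp_continuous_on holomorphic_on_subset[OF hol]) simp
  define M where "M = (LINT x|lborel. norm (w (of_real x) * exp_sum J c \<mu> x / of_real (1 + x\<^sup>2)))"
  have M: "M \<ge> 0" unfolding M_def by (rule Bochner_Integration.integral_nonneg) simp
  \<comment> \<open>In the disc of radius \<open>\<eta>\<close> about \<open>0\<close> all translated singularities are at distance at least \<open>\<eta>\<close>.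
    The number \<open>2\<close> makes the minimum meaningful for empty \<open>J\<close> and gives \<open>\<eta> \<le> 1\<close>.\<close>
  define \<eta> where "\<eta> = Min (insert 2 ((\<lambda>j. \<bar>\<mu> j\<bar>) ` J)) / 2"
  have \<eta>: "\<eta> > 0" "\<eta> \<le> 1" "\<And>j. j \<in> J \<Longrightarrow> 2 * \<eta> \<le> \<bar>\<mu> j\<bar>"
    using J \<mu> by (auto simp: \<eta>_def)
  have "bounded (?\<gamma> ` cball 0 (1 / \<eta>))"
    by (intro compact_imp_bounded compact_continuous_image cont) simp
  then obtain B where "B > 0" "\<forall>u\<in>cball 0 (1 / \<eta>). norm (?\<gamma> u) \<le> B"
    by (auto simp: bounded_pos)
  then have B: "\<And>u. norm u \<le> 1 / \<eta> \<Longrightarrow> norm (?\<gamma> u) \<le> B" "B > 0" "B \<ge> 0" by auto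
  define K where "K = (\<Sum>j\<in>J. norm (c j) * (B / \<eta>))"
  have K: "K \<ge> 0" unfolding K_def using B \<eta> by (intro sum_nonneg) auto
  have shifted: "norm (\<Sum>j\<in>J. c j * ?L (s - \<i> * of_real (\<mu> j))) \<le> K" if s: "norm s \<le> \<eta>" for s
    unfolding K_def
  proof (rule order_trans[OF norm_sum sum_mono])
    fix j assume j: "j \<in> J"
    have "norm (\<i> * of_real (\<mu> j)) - norm s \<le> norm (\<i> * of_real (\<mu> j) - s)"
      by (rule norm_triangle_ineq2)
    then have ge: "\<eta> \<le> norm (s - \<i> * of_real (\<mu> j))"
      using \<eta>(3)[OF j] s by (simp add: norm_mult norm_minus_commute)
    then have "norm (1 / (s - \<i> * of_real (\<mu> j))) \<le> 1 / \<eta>"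
      using \<eta>(1) by (simp add: norm_divide frac_le)
    then have "norm (?L (s - \<i> * of_real (\<mu> j))) \<le> B / \<eta>"
      unfolding borel_transform_def norm_divide[of "deriv_gf w _"] using B ge \<eta>(1) by (intro frac_le) auto
    then show "norm (c j * ?L (s - \<i> * of_real (\<mu> j))) \<le> norm (c j) * (B / \<eta>)"
      unfolding norm_mult by (rule mult_left_mono) simp
  qed
  have L: "norm (?L s) * (Re s)\<^sup>2 \<le> K + 3 * M" if s: "norm s \<le> \<eta>" "Re s \<noteq> 0" for s
  proof -
    let ?X = "\<Sum>j\<in>J. c j * ?L (s - \<i> * of_real (\<mu> j))"
    have "\<bar>Re s\<bar> \<le> 1" using abs_Re_le_cmod[of s] s \<eta> by linarith
    then have r: "(Re s)\<^sup>2 \<le> 1" by (simp add: abs_square_le_1)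
    have "norm (?L s) \<le> norm (?L s + ?X) + norm ?X"
      using norm_triangle_ineq4[of "?L s + ?X" ?X] by (simp only: add_diff_cancel_right')
    also have "\<dots> \<le> M * (1 + 2 / (Re s)\<^sup>2) + K"
      using borel_transform_shifts_bound_nonzero[OF w J int s(2)] shifted[OF s(1)] unfolding M_def
      by (rule add_mono)
    finally have "norm (?L s) * (Re s)\<^sup>2 \<le> (M * (1 + 2 / (Re s)\<^sup>2) + K) * (Re s)\<^sup>2"
      by (rule mult_right_mono) simp
    also have "\<dots> = M * (Re s)\<^sup>2 + 2 * M + K * (Re s)\<^sup>2"
      using s(2) by (simp add: field_simps)
    also have "\<dots> \<le> M * 1 + 2 * M + K * 1"
      by (intro add_mono mult_left_mono r M K) auto
    finally show ?thesis by simp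
  qed
  have bound: "norm (?\<gamma> u) * \<bar>Im (\<i> * u)\<bar> ^ 2 \<le> (B + K + 3 * M) * (1 + norm u) ^ (1 + 2)" for u
  proof (cases "norm u \<le> 1 / \<eta>")
    case True
    have "norm (?\<gamma> u) * \<bar>Im (\<i> * u)\<bar> ^ 2 \<le> B * (1 + norm u) ^ 2"
      using B(1)[OF True] B(3) abs_Re_le_cmod[of u] by (intro mult_mono power_mono) auto
    also have "\<dots> \<le> (B + K + 3 * M) * (1 + norm u) ^ (1 + 2)"
      using B(2) M K by (intro mult_mono power_increasing) auto
    finally show ?thesis .
  next
    case False
    show ?thesis
    proof (cases "Re u = 0")
      case nz: False
      define s where "s = 1 / u"
      have u0: "u \<noteq> 0" using nz by auto
      have us: "Re s = Re u / (norm u)\<^sup>2" by (simp add: s_def Re_divide cmod_power2)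
      have "norm s \<le> \<eta>" using False \<eta>(1) u0 by (simp add: s_def norm_divide field_simps)
      moreover have "Re s \<noteq> 0" using us nz u0 by simp
      ultimately have "norm (?L s) * (Re s)\<^sup>2 \<le> K + 3 * M" by (rule L)
      moreover have "norm (?L s) * (Re s)\<^sup>2 = norm (?\<gamma> u) * (Re u)\<^sup>2 / norm u ^ 3"
      proof -
        have "norm (?L s) = norm (?\<gamma> u) * norm u"
          using u0 by (simp add: borel_transform_def s_def norm_mult)
        moreover have "g * N * (R / N\<^sup>2)\<^sup>2 = g * R\<^sup>2 / N ^ 3" if "N > 0" for g N R :: real
          using that by (simp add: power2_eq_square power3_eq_cube)
        ultimately show ?thesis unfolding us using u0 by simp
      qed
      ultimately have "norm (?\<gamma> u) * (Re u)\<^sup>2 \<le> (K + 3 * M) * norm u ^ 3"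
        using u0 by (simp add: field_simps)
      also have "\<dots> \<le> (B + K + 3 * M) * (1 + norm u) ^ 3"
        using B(2) M K by (intro mult_mono power_mono) auto
      finally show ?thesis by (simp add: numeral_3_eq_3 numeral_2_eq_2)
    qed (use B M K in simp)
  qed
  have "(deriv ^^ n) w 0 = 0" if "n > 1" for n
    using higher_deriv_eq_0_if_bounded_off_line[OF hol _ that bound] higher_deriv_deriv_gf[OF w, of n] by simp
  then have "w z = (deriv ^^ 0) w 0 + (deriv ^^ 1) w 0 * z" for z
    using entire_eq_polynomial[OF whol, of 1 z] by simp
  then show ?thesis by blast
qed

section \<open>An entire kernel with real simple zeros\<close>

lemma continuous_AE_eq_imp_eq:
  fixes f g :: "real \<Rightarrow> complex"
  assumes "continuous_on UNIV f" "continuous_on UNIV g" "AE x in lborel. f x = g x"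
  shows "f x = g x"
proof (rule ccontr)
  assume ne: "f x \<noteq> g x"
  have op: "open {x. f x \<noteq> g x}" by (intro open_Collect_neq assms)
  have "{x. f x \<noteq> g x} \<in> null_sets lborel"
    using assms(3) op by (subst (asm) AE_iff_null) auto
  then have "negligible {x. f x \<noteq> g x}"
    using null_sets_completionI negligible_iff_null_sets by blast
  then show False using open_not_negligible[OF op] ne by blast
qed

text \<open>
  The sine arch over \<open>{0..d}\<close>, continued by \<open>0\<close>; the clamped argument makes continuity evident.
\<close>

definition bump :: "real \<Rightarrow> real \<Rightarrow> complex" where
  "bump d t = of_real (sin (pi * max 0 (min t d) / d))"

definition bump_hat :: "real \<Rightarrow> complex \<Rightarrow> complex" where
  "bump_hat d z = integral {0..d} (\<lambda>t. of_real (sin (pi * t / d)) * cwave t z)"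

lemma bump_hat_holomorphic: "bump_hat d holomorphic_on UNIV"
proof -
  have "(\<lambda>z. integral {0..d} (\<lambda>t. of_real (sin (pi * t / d)) * cwave t z)) holomorphic_on UNIV"
    by (cases "d = 0", simp) (intro cwave_integral_holomorphic continuous_intros, auto)
  then show ?thesis by (simp add: bump_hat_def[abs_def])
qed

text \<open>
  Integration by parts, in the form of an explicit antiderivative. Both sides are multiplied by
  \<open>1 - 4 d\<^sup>2 z\<^sup>2\<close>, so the points \<open>\<plusminus>1 / (2 d)\<close>, where this factor vanishes, need no special treatment.
\<close>

lemma bump_hat_eq:
  assumes d: "d > 0"
  shows "(1 - 4 * of_real d ^ 2 * z\<^sup>2) * bump_hat d z = of_real (d / pi) * (1 + cwave d z)"
proof -
  define b where "b = complex_of_real (pi / d)"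
  define s where "s = 2 * of_real pi * z"
  define P where "P = (\<lambda>t. exp (\<i> * s * t) * (\<i> * s * sin (b * t) - b * cos (b * t)))"
  have f: "of_real (sin (pi * t / d)) * cwave t z = sin (b * of_real t) * exp (\<i> * s * of_real t)" for t
    by (simp add: cwave_def s_def b_def mult_ac flip: sin_of_real)
  have deriv: "(P has_field_derivative ((b\<^sup>2 - s\<^sup>2) * (sin (b * t) * exp (\<i> * s * t)))) (at t)" for t
    unfolding P_def by (rule derivative_eq_intros refl)+ (simp add: algebra_simps power2_eq_square)
  have "((\<lambda>t::real. (b\<^sup>2 - s\<^sup>2) * (sin (b * of_real t) * exp (\<i> * s * of_real t))) has_integral
      P (of_real d) - P (of_real 0)) {0..d}"
  proof (rule fundamental_theorem_of_calculus)
    show "0 \<le> d" using d by simp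
    fix x :: real
    show "((\<lambda>t. P (of_real t)) has_vector_derivative
        (b\<^sup>2 - s\<^sup>2) * (sin (b * of_real x) * exp (\<i> * s * of_real x))) (at x within {0..d})"
      by (rule has_vector_derivative_at_within[OF has_vector_derivative_real_field[OF deriv]])
  qed
  then have "integral {0..d} (\<lambda>t::real. (b\<^sup>2 - s\<^sup>2) * (sin (b * of_real t) * exp (\<i> * s * of_real t)))
      = P (of_real d) - P (of_real 0)"
    by (rule integral_unique)
  moreover have "integral {0..d} (\<lambda>t::real. (b\<^sup>2 - s\<^sup>2) * (sin (b * of_real t) * exp (\<i> * s * of_real t)))
      = (b\<^sup>2 - s\<^sup>2) * integral {0..d} (\<lambda>t::real. sin (b * of_real t) * exp (\<i> * s * of_real t))"
    by (rule integral_mult_right)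
  moreover have "integral {0..d} (\<lambda>t::real. sin (b * of_real t) * exp (\<i> * s * of_real t)) = bump_hat d z"
    by (simp only: bump_hat_def f)
  moreover have "b * of_real d = of_real pi" using d by (simp add: b_def)
  moreover have "exp (\<i> * s * of_real d) = cwave d z" by (simp add: cwave_def s_def mult_ac)
  ultimately have *: "(b\<^sup>2 - s\<^sup>2) * bump_hat d z = b * (1 + cwave d z)"
    by (simp add: P_def distrib_left sin_of_real cos_of_real)
  have "1 - 4 * of_real d ^ 2 * z\<^sup>2 = of_real (d / pi) ^ 2 * (b\<^sup>2 - s\<^sup>2)"
    using d by (simp add: b_def s_def field_simps power2_eq_square)
  then have "(1 - 4 * of_real d ^ 2 * z\<^sup>2) * bump_hat d z = of_real (d / pi) ^ 2 * (b * (1 + cwave d z))"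
    by (simp only: mult.assoc *)
  also have "\<dots> = of_real (d / pi) * (1 + cwave d z)"
    using d by (simp add: b_def power2_eq_square)
  finally show ?thesis .
qed

text \<open>
  A zero satisfies \<open>exp (2 \<pi> \<i> d z) = - 1\<close>, hence is real. Differentiation of \<open>bump_hat_eq\<close> at a zero leaves
  the nonzero derivative of the exponential on the right, so the zero is simple.
\<close>

lemma bump_hat_zero:
  assumes d: "d > 0" and z: "bump_hat d z = 0"
  shows "Im z = 0" and "deriv (bump_hat d) z \<noteq> 0"
proof -
  have "of_real (d / pi) * (1 + cwave d z) = 0" using bump_hat_eq[OF d, of z] z by simp
  then have m1: "cwave d z = - 1" using d by (simp add: add_eq_0_iff)
  then have "norm (cwave d z) = 1" by simp
  then show "Im z = 0" using d by (simp add: norm_cwave)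
  have D: "(bump_hat d has_field_derivative deriv (bump_hat d) z) (at z)"
    by (rule holomorphic_derivI[OF bump_hat_holomorphic]) auto
  have "((\<lambda>z. (1 - 4 * of_real d ^ 2 * z\<^sup>2) * bump_hat d z) has_field_derivative
      (1 - 4 * of_real d ^ 2 * z\<^sup>2) * deriv (bump_hat d) z) (at z)"
    by (rule derivative_eq_intros D refl)+ (simp add: z)
  moreover have "((\<lambda>z. of_real (d / pi) * (1 + cwave d z)) has_field_derivative
      of_real (d / pi) * (2 * of_real pi * \<i> * of_real d * cwave d z)) (at z)"
    by (rule derivative_eq_intros refl)+ simp
  ultimately have "(1 - 4 * of_real d ^ 2 * z\<^sup>2) * deriv (bump_hat d) z
      = of_real (d / pi) * (2 * of_real pi * \<i> * of_real d * cwave d z)"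
    unfolding bump_hat_eq[OF d] by (rule DERIV_unique)
  then show "deriv (bump_hat d) z \<noteq> 0" using d m1 by auto
qed

lemma bump_hat_0: assumes "d > 0" shows "bump_hat d 0 \<noteq> 0"
  using bump_hat_eq[OF assms, of 0] assms by (auto simp: cwave_def)

lemma norm_bump_hat_real:
  assumes d: "d > 0" shows "norm (bump_hat d (of_real x)) \<le> d"
proof -
  have "norm (integral {0..d} (\<lambda>t. of_real (sin (pi * t / d)) * cwave t (of_real x))) \<le> 1 * (d - 0)"
  proof (rule integral_bound)
    show "norm (of_real (sin (pi * t / d)) * cwave t (of_real x)) \<le> 1" for t
      by (simp add: norm_mult cwave_of_real)
  qed (use d in \<open>auto intro!: continuous_intros\<close>)
  then show ?thesis by (simp add: bump_hat_def)
qed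

lemma integrable_inverse_1_plus_sq: "integrable lborel (\<lambda>x::real. inverse (1 + x\<^sup>2))"
  using integrable_inverse_1_plus_square by (simp add: set_integrable_def)

lemma bump_hat_measurable [measurable]: "(\<lambda>x. bump_hat d (of_real x)) \<in> borel_measurable borel"
  by (intro borel_measurable_continuous_onI
      continuous_on_compose2[OF holomorphic_on_imp_continuous_on[OF bump_hat_holomorphic]] continuous_intros) auto

text \<open>
  By \<open>bump_hat_eq\<close> the kernel decays like \<open>x\<^sup>-\<^sup>2\<close>.
\<close>

lemma integrable_bump_hat:
  assumes d: "d > 0" shows "integrable lborel (\<lambda>x. bump_hat d (of_real x))"
proof -
  define K where "K = d + (2 * d / pi + d) / (4 * d\<^sup>2)"
  have "norm (bump_hat d (of_real x)) \<le> norm (K * inverse (1 + x\<^sup>2))" for x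
  proof -
    let ?N = "norm (bump_hat d (of_real x))"
    have "norm ((1 - 4 * of_real d ^ 2 * (of_real x)\<^sup>2) * bump_hat d (of_real x)) = d / pi * norm (1 + cwave d (of_real x))"
      unfolding bump_hat_eq[OF d] using d by (simp add: norm_mult norm_divide)
    also have "\<dots> \<le> d / pi * 2"
      using norm_triangle_ineq[of 1 "cwave d (of_real x)"] d
      by (intro mult_left_mono) (auto simp: cwave_of_real)
    also have "1 - 4 * of_real d ^ 2 * (of_real x)\<^sup>2 = complex_of_real (1 - 4 * d\<^sup>2 * x\<^sup>2)" by simp
    finally have "\<bar>1 - 4 * d\<^sup>2 * x\<^sup>2\<bar> * ?N \<le> d / pi * 2"
      by (simp only: norm_mult norm_of_real)
    moreover have "(4 * d\<^sup>2 * x\<^sup>2 - 1) * ?N \<le> \<bar>1 - 4 * d\<^sup>2 * x\<^sup>2\<bar> * ?N"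
      by (intro mult_right_mono) auto
    ultimately have "4 * d\<^sup>2 * x\<^sup>2 * ?N \<le> 2 * d / pi + ?N" by (simp add: algebra_simps)
    also have "\<dots> \<le> 2 * d / pi + d" using norm_bump_hat_real[OF d, of x] by simp
    finally have "x\<^sup>2 * ?N \<le> (2 * d / pi + d) / (4 * d\<^sup>2)" using d by (simp add: field_simps)
    then have "(1 + x\<^sup>2) * ?N \<le> K"
      using norm_bump_hat_real[OF d, of x] by (simp add: K_def distrib_right)
    moreover have "1 + x\<^sup>2 > 0" by (simp add: add_pos_nonneg)
    ultimately have "?N \<le> K * inverse (1 + x\<^sup>2)" by (simp add: field_simps)
    then show ?thesis by (rule order_trans) simp
  qed
  then show ?thesis
    by (intro Bochner_Integration.integrable_bound[OF integrable_mult_right[OF integrable_inverse_1_plus_sq]] AE_I2)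
      measurable
qed

lemma bump_eq_0: "d > 0 \<Longrightarrow> t \<notin> {0<..<d} \<Longrightarrow> bump d t = 0"
  by (auto simp: bump_def not_less max_def min_def)

lemma bump_nonzero: "t \<in> {0<..<d} \<Longrightarrow> bump d t \<noteq> 0"
  using sin_gt_zero[of "pi * t / d"] by (simp add: bump_def field_simps)

lemma continuous_bump: "d > 0 \<Longrightarrow> continuous_on A (bump d)"
  unfolding bump_def by (intro continuous_intros) auto

lemma fourier_bump:
  assumes d: "d > 0"
  shows "integrable lborel (bump d)" and "fourier (bump d) x = bump_hat d (of_real (- x))"
proof -
  have eq: "bump d t = indicator {0..d} t *\<^sub>R bump d t" for t
    using bump_eq_0[OF d, of t] by (auto simp: indicator_def)
  have "set_integrable lborel {0..d} (bump d)"
    by (rule borel_integrable_atLeastAtMost'[OF continuous_bump[OF d]])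
  then show "integrable lborel (bump d)"
    unfolding set_integrable_def eq[symmetric] .
  have "fourier (bump d) x = (LINT t:{0..d}|lborel. wave (- x) t * bump d t)"
    unfolding fourier_wave set_lebesgue_integral_def
    by (intro Bochner_Integration.integral_cong refl) (auto simp: indicator_def bump_eq_0[OF d])
  also have "\<dots> = (LINT t:{0..d}|lborel. of_real (sin (pi * t / d)) * cwave t (of_real (- x)))"
    by (intro set_lebesgue_integral_cong)
       (auto simp: bump_def wave_def cwave_def mult_ac max_def min_def)
  also have "\<dots> = bump_hat d (of_real (- x))"
    unfolding bump_hat_def using d
    by (intro set_borel_integral_eq_integral(2) borel_integrable_atLeastAtMost' continuous_intros) auto
  finally show "fourier (bump d) x = bump_hat d (of_real (- x))" .
qed

text \<open>
  Inversion applied to \<open>bump d\<close>, whose transform is integrable; the equality holds everywhere because both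
  sides are continuous.
\<close>

lemma fourier_bump_hat:
  assumes d: "d > 0" shows "fourier (\<lambda>x. bump_hat d (of_real x)) t = bump d t"
proof -
  let ?f = "\<lambda>x. bump_hat d (of_real x)"
  have "integrable lborel (\<lambda>x. ?f (0 + (- 1) * x))"
    by (rule lborel_integrable_real_affine[OF integrable_bump_hat[OF d]]) simp
  then have int: "integrable lborel (fourier (bump d))"
    by (simp add: fourier_bump(2)[OF d, abs_def])
  have "(LINT x|lborel. wave t x * fourier (bump d) x) = fourier ?f t" for t
    using lborel_integral_real_affine[of "- 1" "\<lambda>x. wave (- t) x * ?f x" 0]
    unfolding fourier_bump(2)[OF d] unfolding fourier_wave by (simp add: wave_def)
  then have ae: "AE t in lborel. bump d t = fourier ?f t"
    using fourier_inversion[OF fourier_bump(1)[OF d] int] by simp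
  have "continuous_on UNIV (fourier ?f)"
    by (intro continuous_at_imp_continuous_on ballI isCont_fourier integrable_bump_hat d)
  from continuous_AE_eq_imp_eq[OF continuous_bump[OF d] this ae] show ?thesis by simp
qed

section \<open>The functions with spectrum in two symmetric bands\<close>

definition band :: "real \<Rightarrow> real \<Rightarrow> real \<Rightarrow> complex" where
  "band d b x = wave b x * bump_hat d (of_real x)"

lemma band_eq: "band d b x = cwave b (of_real x) * bump_hat d (of_real x)"
  by (simp add: band_def cwave_of_real)

lemma integrable_band: "d > 0 \<Longrightarrow> integrable lborel (band d b)"
  unfolding band_def[abs_def] by (simp add: integrable_bump_hat)

lemma fourier_band: "d > 0 \<Longrightarrow> fourier (band d b) t = bump d (t - b)"
  unfolding band_def[abs_def] by (simp only: fourier_wave_mult fourier_bump_hat)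

text \<open>
  The bands are \<open>a - d \<le> \<bar>t\<bar> \<le> 2 a + d\<close>. Each of the intervals \<open>\<plusminus>a + [0, d]\<close> and \<open>\<plusminus>2 a + [0, d]\<close> is contained
  in one of them, and \<open>2 a + [0, d]\<close> reaches the endpoint \<open>2 a + d\<close>.
\<close>

locale two_bands =
  fixes a d :: real
  assumes d: "0 < d" and da: "d < a"
begin

definition S :: "real set" where
  "S = {- (2 * a + d)..- (a - d)} \<union> {a - d..2 * a + d}"

text \<open>
  In terms of \<open>\<theta> = 2 \<pi> a z\<close>, the function \<open>F c\<close> is \<open>2 sin \<theta> (c + cos \<theta>) bump_hat d\<close>, given by its
  components \<open>Fm c\<close> and \<open>Fp c\<close> with spectrum in the negative and in the positive band, and \<open>Q\<close> is
  \<open>2 sin \<theta> bump_hat d\<close>.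
\<close>

definition Fp :: "real \<Rightarrow> complex \<Rightarrow> complex" where
  "Fp c z = (2 * of_real c * cwave a z + cwave (2 * a) z) * bump_hat d z / (2 * \<i>)"

definition Fm :: "real \<Rightarrow> complex \<Rightarrow> complex" where
  "Fm c z = - (2 * of_real c * cwave (- a) z + cwave (- (2 * a)) z) * bump_hat d z / (2 * \<i>)"

definition F :: "real \<Rightarrow> complex \<Rightarrow> complex" where
  "F c z = Fm c z + Fp c z"

definition Q :: "complex \<Rightarrow> complex" where
  "Q z = (cwave a z - cwave (- a) z) * bump_hat d z / \<i>"

lemma closed_S: "closed S"
  unfolding S_def by (intro closed_Un closed_atLeastAtMost)

lemma Fp_holomorphic: "Fp c holomorphic_on UNIV" and Fm_holomorphic: "Fm c holomorphic_on UNIV"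
  and F_holomorphic: "F c holomorphic_on UNIV"
  unfolding F_def[abs_def] Fp_def[abs_def] Fm_def[abs_def]
  by (intro holomorphic_intros bump_hat_holomorphic; simp)+

lemma Fp_real: "Fp c (of_real x) = of_real c / \<i> * band d a x + 1 / (2 * \<i>) * band d (2 * a) x"
  and Fm_real: "Fm c (of_real x) = - of_real c / \<i> * band d (- a) x + (- 1 / (2 * \<i>)) * band d (- (2 * a)) x"
  and Q_real: "Q (of_real x) = 1 / \<i> * band d a x + (- 1 / \<i>) * band d (- a) x"
  by (simp_all add: Fp_def Fm_def Q_def band_eq field_simps)

lemma Fp_factor: "Fp c z = cwave a z * (of_real (2 * c) + cwave a z) / (2 * \<i>) * bump_hat d z"
  unfolding Fp_def cwave_double by (simp add: power2_eq_square algebra_simps)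

lemma fourier_two_bands:
  "fourier (\<lambda>x. \<alpha> * band d b x + \<beta> * band d b' x) t = \<alpha> * bump d (t - b) + \<beta> * bump d (t - b')"
  by (simp only: fourier_add[OF integrable_mult_right[OF integrable_band[OF d]]
        integrable_mult_right[OF integrable_band[OF d]]] fourier_cmult fourier_band[OF d])

lemma fourier_Fp: "fourier (\<lambda>x. Fp c (of_real x)) t = of_real c / \<i> * bump d (t - a) + 1 / (2 * \<i>) * bump d (t - 2 * a)"
  and fourier_Fm: "fourier (\<lambda>x. Fm c (of_real x)) t = - of_real c / \<i> * bump d (t + a) + (- 1 / (2 * \<i>)) * bump d (t + 2 * a)"
  and fourier_Q: "fourier (\<lambda>x. Q (of_real x)) t = 1 / \<i> * bump d (t - a) + (- 1 / \<i>) * bump d (t + a)"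
  by (simp_all only: Fp_real Fm_real Q_real fourier_two_bands diff_minus_eq_add)

lemma integrable_Fp: "integrable lborel (\<lambda>x. Fp c (of_real x))"
  and integrable_Fm: "integrable lborel (\<lambda>x. Fm c (of_real x))"
  and integrable_Q: "integrable lborel (\<lambda>x. Q (of_real x))"
  unfolding Fp_real Fm_real Q_real
  by (intro Bochner_Integration.integrable_add integrable_mult_right integrable_band d)+

lemma Fp_PW1: "(\<lambda>x. Fp c (of_real x)) \<in> PW1 {a - d..2 * a + d}"
  using d da by (auto simp: PW1_iff integrable_Fp fourier_Fp bump_eq_0)

lemma Fm_PW1: "(\<lambda>x. Fm c (of_real x)) \<in> PW1 {- (2 * a + d)..- (a - d)}"
  using d da by (auto simp: PW1_iff integrable_Fm fourier_Fm bump_eq_0)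

lemma F_PW1: "(\<lambda>x. F c (of_real x)) \<in> PW1 S"
  unfolding F_def
  by (rule PW1_add[OF closed_S PW1_mono[OF Fm_PW1] PW1_mono[OF Fp_PW1]]) (auto simp: S_def)

lemma Q_PW1: "(\<lambda>x. Q (of_real x)) \<in> PW1 S"
  unfolding PW1_iff[OF closed_S] unfolding S_def using d da
  by (auto simp: integrable_Q fourier_Q bump_eq_0)

text \<open>
  Only the piece of \<open>F\<close> shifted by \<open>2 a\<close> is visible between \<open>2 a\<close> and \<open>2 a + d\<close>. This places the endpoint in
  the spectrum of \<open>F\<close> and separates \<open>F\<close> from \<open>Q\<close>.
\<close>

lemma fourier_F_top:
  assumes "t \<in> {2 * a<..<2 * a + d}"
  shows "fourier (\<lambda>x. F c (of_real x)) t \<noteq> 0" and "fourier (\<lambda>x. Q (of_real x)) t = 0"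
proof -
  have "fourier (\<lambda>x. F c (of_real x)) t = 1 / (2 * \<i>) * bump d (t - 2 * a)"
    unfolding F_def using d da assms
    by (simp add: fourier_add integrable_Fp integrable_Fm fourier_Fp fourier_Fm bump_eq_0)
  then show "fourier (\<lambda>x. F c (of_real x)) t \<noteq> 0"
    using assms bump_nonzero[of "t - 2 * a" d] by auto
  show "fourier (\<lambda>x. Q (of_real x)) t = 0"
    using d da assms by (simp add: fourier_Q bump_eq_0)
qed

lemma F_eq_Q: "F c (of_real x) = of_real (c + cos (2 * pi * a * x)) * Q (of_real x)"
proof -
  let ?e = "cwave a (of_real x)" and ?p = "bump_hat d (of_real x)"
  have cos: "complex_of_real (cos (2 * pi * a * x)) = (?e + inverse ?e) / 2"
    unfolding cwave_def cos_of_real[symmetric] cos_exp_eq by (simp add: exp_minus mult_ac)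
  have "?e * inverse ?e = 1" by simp
  then show ?thesis
    unfolding of_real_add cos F_def Fp_def Fm_def Q_def cwave_minus cwave_double
    by (simp add: field_simps power2_eq_square)
qed

lemma Q_norm_pos: "norm1 (\<lambda>x. Q (of_real x)) > 0"
proof (rule norm1_pos[OF integrable_Q])
  have "bump d (d / 2) \<noteq> 0" using d by (intro bump_nonzero) auto
  moreover have "bump d (a + d / 2 + a) = 0" using d da by (intro bump_eq_0) auto
  ultimately show "fourier (\<lambda>x. Q (of_real x)) (a + d / 2) \<noteq> 0"
    by (simp add: fourier_Q)
qed

definition N :: "real \<Rightarrow> real" where "N c = norm1 (\<lambda>x. F c (of_real x))"

lemma N_pos: "N c > 0"
  unfolding N_def using d da F_PW1
  by (intro norm1_pos[OF _ fourier_F_top(1)[of "2 * a + d / 2"]]) (auto simp: PW1_def)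

definition f :: "real \<Rightarrow> real \<Rightarrow> complex" where
  "f c x = of_real (1 / N c) * F c (of_real x)"

definition q :: "real \<Rightarrow> complex" where
  "q x = of_real (1 / norm1 (\<lambda>x. Q (of_real x))) * Q (of_real x)"

lemma f_PW1: "f c \<in> PW1 S"
  unfolding f_def[abs_def] by (intro PW1_cmult closed_S F_PW1)

lemma q_PW1: "q \<in> PW1 S"
  unfolding q_def[abs_def] by (intro PW1_cmult closed_S Q_PW1)

lemma norm1_f: "norm1 (f c) = 1"
  unfolding f_def[abs_def] norm1_cmult norm_of_real N_def[symmetric] using N_pos[of c] by simp

lemma norm1_q: "norm1 q = 1"
  unfolding q_def[abs_def] norm1_cmult norm_of_real using Q_norm_pos by simp

lemma fourier_f_top: "t \<in> {2 * a<..<2 * a + d} \<Longrightarrow> fourier (f c) t \<noteq> 0"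
  unfolding f_def[abs_def] fourier_cmult using fourier_F_top(1) N_pos[of c] by simp

lemma not_eq_ae_f_q: "\<not> eq_ae (f c) q" "\<not> eq_ae q (f c)"
proof -
  have t: "2 * a + d / 2 \<in> {2 * a<..<2 * a + d}" using d by auto
  have "fourier q (2 * a + d / 2) = 0"
    unfolding q_def[abs_def] fourier_cmult fourier_F_top(2)[OF t] by simp
  then have "fourier (f c) \<noteq> fourier q" using fourier_f_top[OF t, of c] by metis
  moreover have "integrable lborel (f c)" "integrable lborel q" using f_PW1 q_PW1 by (auto simp: PW1_def)
  ultimately show "\<not> eq_ae (f c) q" "\<not> eq_ae q (f c)"
    using fourier_cong_AE by metis+
qed

lemma top_in_Sp: "2 * a + d \<in> Sp (f c)"
proof -
  have "2 * a + d \<in> closure {2 * a<..<2 * a + d}" using d by simp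
  also have "\<dots> \<subseteq> Sp (f c)"
    unfolding Sp_def by (intro closure_mono) (use fourier_f_top in auto)
  finally show ?thesis .
qed

lemma f_eq_q:
  "f c x = of_real ((c + cos (2 * pi * a * x)) * (norm1 (\<lambda>x. Q (of_real x)) / N c)) * q x"
  unfolding f_def q_def F_eq_Q using Q_norm_pos by simp

lemma spectral_parts_f:
  "spectral_parts (a - d) (2 * a + d) (f c) (\<lambda>z. of_real (1 / N c) * Fm c z) (\<lambda>z. of_real (1 / N c) * Fp c z)"
  unfolding spectral_parts_def
proof (intro conjI)
  show "(\<lambda>z. of_real (1 / N c) * Fm c z) holomorphic_on UNIV" "(\<lambda>z. of_real (1 / N c) * Fp c z) holomorphic_on UNIV"
    by (intro holomorphic_intros Fm_holomorphic Fp_holomorphic)+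
  show "(\<lambda>x. of_real (1 / N c) * Fm c (of_real x)) \<in> PW1 {- (2 * a + d)..- (a - d)}"
    "(\<lambda>x. of_real (1 / N c) * Fp c (of_real x)) \<in> PW1 {a - d..2 * a + d}"
    by (intro PW1_cmult Fm_PW1 Fp_PW1; simp)+
  show "eq_ae (f c) (\<lambda>x. of_real (1 / N c) * Fm c (of_real x) + of_real (1 / N c) * Fp c (of_real x))"
    by (simp add: eq_ae_def f_def F_def distrib_left)
qed

lemma f_not_Ext: assumes "c > 1" shows "f c \<notin> Ext_PW1 S"
proof (rule not_Ext_if_ratio_bounded_below[OF closed_S f_PW1 norm1_f q_PW1 norm1_q f_eq_q])
  let ?r = "norm1 (\<lambda>x. Q (of_real x)) / N c"
  show "(c - 1) * ?r > 0" using assms Q_norm_pos N_pos[of c] by simp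
  show "(c - 1) * ?r \<le> (c + cos (2 * pi * a * x)) * ?r" for x
    using cos_ge_minus_one[of "2 * pi * a * x"] Q_norm_pos N_pos[of c] by (intro mult_right_mono) auto
qed (rule not_eq_ae_f_q)

text \<open>
  Where \<open>1 + cos \<theta>\<close> vanishes, \<open>sin \<theta>\<close> and with it \<open>q\<close> vanish as well, as the criterion requires.
\<close>

lemma f_not_Exp: "f 1 \<notin> Exp_PW1 S"
proof (rule not_Exp_if_ratio_nonneg[OF closed_S f_PW1 norm1_f q_PW1 norm1_q f_eq_q])
  let ?r = "norm1 (\<lambda>x. Q (of_real x)) / N 1"
  have r: "?r > 0" using Q_norm_pos N_pos[of 1] by simp
  show "0 \<le> (1 + cos (2 * pi * a * x)) * ?r" for x
  proof (rule mult_nonneg_nonneg)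
    show "0 \<le> 1 + cos (2 * pi * a * x)" using cos_ge_minus_one[of "2 * pi * a * x"] by linarith
  qed (use r in simp)
  fix x assume "(1 + cos (2 * pi * a * x)) * ?r = 0"
  then have "1 + cos (2 * pi * a * x) = 0" using r by (metis mult_eq_0_iff less_irrefl)
  then have cos: "cos (2 * pi * a * x) = - 1" by linarith
  then have sin: "sin (2 * pi * a * x) = 0"
    using sin_cos_squared_add[of "2 * pi * a * x"] by simp
  have "cwave a (of_real x) = cis (2 * pi * a * x)" "cwave (- a) (of_real x) = cis (- (2 * pi * a * x))"
    by (simp_all add: cwave_def cis_conv_exp mult_ac)
  then have "cwave a (of_real x) = cwave (- a) (of_real x)"
    using sin by (simp add: complex_eq_iff)
  then show "q x = 0" by (simp add: q_def Q_def)
qed (rule not_eq_ae_f_q)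

text \<open>
  The values of \<open>cwave a\<close> at conjugate points have moduli with product \<open>1\<close>, so both moduli cannot be
  \<open>2 c > 1\<close>.
\<close>

lemma Lambda_fp: assumes "c > 1 / 2" shows "Lambda (\<lambda>z. of_real (1 / N c) * Fp c z) = {}"
proof -
  have *: "norm (cwave a z) = 2 * c" if "Fp c z = 0" "Im z \<noteq> 0" for z
  proof -
    have "bump_hat d z \<noteq> 0" using bump_hat_zero(1)[OF d, of z] that by auto
    moreover have "cwave a z * (of_real (2 * c) + cwave a z) / (2 * \<i>) * bump_hat d z = 0"
      using that(1) by (simp only: Fp_factor)
    ultimately have "of_real (2 * c) + cwave a z = 0"
      by (simp del: of_real_mult)
    then have "cwave a z = - of_real (2 * c)" by (simp only: add_eq_0_iff)
    then have "norm (cwave a z) = \<bar>2 * c\<bar>" by (simp only: norm_minus_cancel norm_of_real)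
    then show ?thesis using assms by simp
  qed
  have False if "Fp c l = 0" "Fp c (cnj l) = 0" "Im l \<noteq> 0" for l
  proof -
    have "norm (cwave a l) * norm (cwave a (cnj l)) = (2 * c) * (2 * c)"
      using *[of l] *[of "cnj l"] that by simp
    moreover have "norm (cwave a l) * norm (cwave a (cnj l)) = 1"
      by (simp add: norm_cwave flip: exp_add)
    moreover have "(2 * c) * (2 * c) > 1 * 1" using assms by (intro mult_strict_mono) auto
    ultimately show False by simp
  qed
  then show ?thesis
    using N_pos[of c] by (auto simp: Lambda_def complex_is_Real_iff)
qed

text \<open>
  On the real line the factor \<open>2 c + cwave a\<close> has no zeros, so the real zeros are those of the kernel, and
  they are simple.
\<close>

lemma Omega_points_fp: assumes "c > 1 / 2" shows "Omega_points (\<lambda>z. of_real (1 / N c) * Fp c z) = {}"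
proof -
  let ?g = "\<lambda>z. of_real (1 / N c) * Fp c z"
  define u where "u = (\<lambda>z. of_real (1 / N c) * (cwave a z * (of_real (2 * c) + cwave a z) / (2 * \<i>)))"
  define h where "h = (\<lambda>z. u z * bump_hat d z)"
  have g: "?g = h" by (simp only: Fp_factor u_def h_def mult.assoc)
  have u: "u (of_real x) \<noteq> 0" for x
  proof
    assume "u (of_real x) = 0"
    then have "of_real (2 * c) + cwave a (of_real x) = 0"
      using N_pos[of c] by (simp add: u_def del: of_real_mult)
    then have "cwave a (of_real x) = - of_real (2 * c)" by (simp only: add_eq_0_iff)
    then have "norm (cwave a (of_real x)) = \<bar>2 * c\<bar>" by (simp only: norm_minus_cancel norm_of_real)
    then show False using assms by (simp add: cwave_of_real)
  qed
  have "h 0 \<noteq> 0" unfolding h_def using u[of 0] bump_hat_0[OF d] by simp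
  then have nz: "\<not> (\<forall>z. h z = 0)" by blast
  have uhol: "u holomorphic_on UNIV" unfolding u_def by (intro holomorphic_intros) auto
  have hol: "h holomorphic_on UNIV"
    unfolding h_def by (intro holomorphic_intros uhol bump_hat_holomorphic)
  have "nat (zorder h (of_real x)) div 2 = 0" for x
  proof (cases "bump_hat d (of_real x) = 0")
    case False
    then have "zorder h (of_real x) = 0"
      by (intro zorder_eq_0I holomorphic_on_imp_analytic_at[OF hol]) (auto simp: h_def u)
    then show ?thesis by simp
  next
    case True
    have "(u has_field_derivative deriv u (of_real x)) (at (of_real x))"
      by (rule holomorphic_derivI[OF uhol]) auto
    moreover have "(bump_hat d has_field_derivative deriv (bump_hat d) (of_real x)) (at (of_real x))"
      by (rule holomorphic_derivI[OF bump_hat_holomorphic]) auto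
    ultimately have "(h has_field_derivative
        deriv u (of_real x) * bump_hat d (of_real x) + deriv (bump_hat d) (of_real x) * u (of_real x)) (at (of_real x))"
      unfolding h_def by (rule DERIV_mult)
    then have "deriv h (of_real x) \<noteq> 0"
      using u bump_hat_zero(2)[OF d True] by (simp add: DERIV_imp_deriv True)
    then have "zorder h (of_real x) = 1"
      by (intro zorder_zero_eqI[OF hol]) (auto simp: h_def True)
    then show ?thesis by simp
  qed
  then show ?thesis
    unfolding g using nz by (simp add: Omega_points_def Omega_count_def zero_enat_def)
qed

section \<open>Extremality\<close>

lemma F_1_product:
  "F 1 z * (1 - 4 * of_real d ^ 2 * z\<^sup>2) =
    (cwave a z)\<^sup>2 * ((1 - (inverse (cwave a z))\<^sup>2) * (1 + inverse (cwave a z))\<^sup>2) / (2 * \<i>) *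
    (of_real (d / pi) * (cwave d z * (1 + inverse (cwave d z))))"
proof -
  define e where "e = cwave a z"
  have e0: "e \<noteq> 0" by (simp add: e_def)
  have "F 1 z * (1 - 4 * of_real d ^ 2 * z\<^sup>2) = (2 * e + e\<^sup>2 - 2 * inverse e - (inverse e)\<^sup>2) / (2 * \<i>)
      * ((1 - 4 * of_real d ^ 2 * z\<^sup>2) * bump_hat d z)"
    unfolding F_def Fp_def Fm_def cwave_minus cwave_double e_def[symmetric] using e0
    by (simp add: field_simps)
  also have "\<dots> = (2 * e + e\<^sup>2 - 2 * inverse e - (inverse e)\<^sup>2) / (2 * \<i>) * (of_real (d / pi) * (1 + cwave d z))"
    unfolding bump_hat_eq[OF d] ..
  also have "2 * e + e\<^sup>2 - 2 * inverse e - (inverse e)\<^sup>2 = e\<^sup>2 * ((1 - (inverse e)\<^sup>2) * (1 + inverse e)\<^sup>2)"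
    using e0 by (simp add: field_simps power2_eq_square)
  also have "1 + cwave d z = cwave d z * (1 + inverse (cwave d z))" by (simp add: field_simps)
  finally show ?thesis unfolding e_def .
qed

lemma F_1_nonzero: assumes "Im z \<noteq> 0" shows "F 1 z \<noteq> 0"
proof
  assume "F 1 z = 0"
  then have "(inverse (cwave a z))\<^sup>2 = 1 \<or> inverse (cwave a z) = - 1 \<or> inverse (cwave d z) = - 1"
    using F_1_product[of z] d by (auto simp: add_eq_0_iff)
  then have "norm (inverse (cwave a z)) = 1 \<or> norm (inverse (cwave d z)) = 1"
    by (metis norm_minus_cancel norm_one power2_eq_1_iff)
  then show False
    unfolding cwave_minus[symmetric] norm_cwave using assms d da by auto
qed

text \<open>
  In the lower half-plane \<open>cwave a\<close> and \<open>cwave d\<close> are large. In \<open>F_1_product\<close> they contribute exactly the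
  growth \<open>exp (2 \<pi> (2 a + d) \<bar>Im z\<bar>)\<close>, and each of the four remaining factors that can be small is at least
  \<open>1 - exp (- 2 \<pi> d \<bar>Im z\<bar>)\<close>. Such a factor is bounded below by a multiple of \<open>\<bar>Im z\<bar> / (1 + \<bar>z\<bar>)\<close>.
\<close>

lemma F_lower_half_plane_bound:
  "\<exists>C\<ge>0. \<forall>z. Im z < 0 \<longrightarrow>
    exp (2 * pi * (2 * a + d) * \<bar>Im z\<bar>) * \<bar>Im z\<bar> ^ 4 \<le> C * (1 + norm z) ^ 6 * norm (F 1 z)"
proof -
  define C where "C = (2 * pi / d) * (1 + 4 * d\<^sup>2) * ((1 + 2 * pi * d) / (2 * pi * d)) ^ 4"
  have C: "C \<ge> 0" using d by (simp add: C_def)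
  have "exp (2 * pi * (2 * a + d) * \<bar>Im z\<bar>) * \<bar>Im z\<bar> ^ 4 \<le> C * (1 + norm z) ^ 6 * norm (F 1 z)"
    if z: "Im z < 0" for z
  proof -
    define Y where "Y = - Im z"
    have Y: "Y > 0" using z by (simp add: Y_def)
    define e where "e = cwave a z"
    define p where "p = cwave d z"
    define r where "r = exp (- (2 * pi * d * Y))"
    have r: "0 < r" "r < 1" using Y d by (auto simp: r_def)
    have ne: "norm (inverse e) \<le> r"
      unfolding e_def cwave_minus[symmetric] norm_cwave r_def using Y da d
      by (simp add: Y_def mult_left_mono_neg)
    have np: "norm (inverse p) = r"
      unfolding p_def cwave_minus[symmetric] norm_cwave r_def by (simp add: Y_def)
    have e0: "e \<noteq> 0" "p \<noteq> 0" by (auto simp: e_def p_def)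
    have eq: "norm (F 1 z) * norm (1 - 4 * of_real d ^ 2 * z\<^sup>2) = d / (2 * pi) * (norm e ^ 2 * norm p) *
        (norm (1 - (inverse e)\<^sup>2) * norm (1 + inverse e) ^ 2 * norm (1 + inverse p))"
      unfolding norm_mult[symmetric, of "F 1 z"] F_1_product e_def[symmetric] p_def[symmetric] using d
      by (simp add: norm_mult norm_divide norm_power mult_ac)
    have "norm e ^ 2 * norm p = exp (2 * pi * (2 * a + d) * Y)"
      unfolding e_def p_def norm_cwave exp_of_nat_mult[symmetric] exp_add[symmetric]
      by (simp add: Y_def algebra_simps)
    have ge: "1 - r \<le> norm (1 + x)" if "norm x \<le> r" for x :: complex
      using norm_triangle_ineq4[of "1 + x" x] that by simp
    have "norm (- (inverse e)\<^sup>2) \<le> r ^ 2" unfolding norm_minus_cancel norm_power using ne by (intro power_mono) auto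
    also have "r ^ 2 \<le> r" using r by (simp add: power2_eq_square mult_left_le)
    finally have ne2: "1 - r \<le> norm (1 - (inverse e)\<^sup>2)" using ge[of "- (inverse e)\<^sup>2"] by simp
    have "(1 - r) ^ 4 = (1 - r) * (1 - r) ^ 2 * (1 - r)" by (simp add: eval_nat_numeral)
    also have "\<dots> \<le> norm (1 - (inverse e)\<^sup>2) * norm (1 + inverse e) ^ 2 * norm (1 + inverse p)"
      using r ne2 ge[OF ne] ge[of "inverse p"] np by (intro mult_mono power_mono mult_nonneg_nonneg) auto
    finally have "d / (2 * pi) * exp (2 * pi * (2 * a + d) * Y) * (1 - r) ^ 4
        \<le> norm (F 1 z) * norm (1 - 4 * of_real d ^ 2 * z\<^sup>2)"
      unfolding eq \<open>norm e ^ 2 * norm p = _\<close> using d by (intro mult_left_mono) auto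
    also have "\<dots> \<le> norm (F 1 z) * ((1 + 4 * d\<^sup>2) * (1 + norm z)\<^sup>2)"
    proof (rule mult_left_mono)
      have "norm (1 - 4 * of_real d ^ 2 * z\<^sup>2) \<le> 1 + 4 * d\<^sup>2 * (norm z)\<^sup>2"
        using norm_triangle_ineq4[of 1 "4 * of_real d ^ 2 * z\<^sup>2"] by (simp add: norm_mult norm_power)
      also have "\<dots> \<le> (1 + 4 * d\<^sup>2) * (1 + norm z)\<^sup>2"
        by (simp add: power2_sum algebra_simps)
      finally show "norm (1 - 4 * of_real d ^ 2 * z\<^sup>2) \<le> (1 + 4 * d\<^sup>2) * (1 + norm z)\<^sup>2" .
    qed simp
    finally have main: "exp (2 * pi * (2 * a + d) * Y) * (1 - r) ^ 4
        \<le> (2 * pi / d) * (1 + 4 * d\<^sup>2) * (1 + norm z)\<^sup>2 * norm (F 1 z)"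
      using d by (simp add: field_simps)
    have "Y \<le> (1 - r) * ((1 + 2 * pi * d) / (2 * pi * d) * (1 + norm z))"
    proof -
      define v where "v = 2 * pi * d * Y"
      have v: "v > 0" using d Y by (simp add: v_def)
      have "1 + v \<le> exp v" by (rule exp_ge_add_one_self)
      then have 1: "v \<le> (1 - exp (- v)) * (1 + v)" using v by (simp add: exp_minus field_simps)
      have "Y \<le> norm z" using abs_Im_le_cmod[of z] z by (simp add: Y_def)
      then have "2 * pi * d * Y \<le> 2 * pi * d * norm z"
        using d by (intro mult_left_mono) auto
      moreover have "(1 + 2 * pi * d) * (1 + norm z) = 1 + norm z + 2 * pi * d + 2 * pi * d * norm z"
        by (simp add: distrib_left distrib_right)
      moreover have "2 * pi * d > 0" using d by simp
      ultimately have "1 + v \<le> (1 + 2 * pi * d) * (1 + norm z)"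
        unfolding v_def using norm_ge_zero[of z] by linarith
      then have 2: "(1 - exp (- v)) * (1 + v) \<le> (1 - exp (- v)) * ((1 + 2 * pi * d) * (1 + norm z))"
        using v by (intro mult_left_mono) auto
      from 1 2 have "v \<le> (1 - r) * ((1 + 2 * pi * d) * (1 + norm z))" by (simp add: r_def v_def)
      then show ?thesis using d by (simp add: v_def field_simps)
    qed
    then have "Y ^ 4 \<le> ((1 - r) * ((1 + 2 * pi * d) / (2 * pi * d) * (1 + norm z))) ^ 4"
      using Y by (intro power_mono) auto
    then have "exp (2 * pi * (2 * a + d) * Y) * Y ^ 4
        \<le> exp (2 * pi * (2 * a + d) * Y) * ((1 - r) * ((1 + 2 * pi * d) / (2 * pi * d) * (1 + norm z))) ^ 4"
      by (rule mult_left_mono) simp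
    also have "\<dots> = exp (2 * pi * (2 * a + d) * Y) * (1 - r) ^ 4 *
        (((1 + 2 * pi * d) / (2 * pi * d)) ^ 4 * (1 + norm z) ^ 4)"
      by (simp only: power_mult_distrib mult.assoc)
    also have "\<dots> \<le> (2 * pi / d) * (1 + 4 * d\<^sup>2) * (1 + norm z)\<^sup>2 * norm (F 1 z) *
        (((1 + 2 * pi * d) / (2 * pi * d)) ^ 4 * (1 + norm z) ^ 4)"
      using main d by (intro mult_right_mono) auto
    also have "\<dots> = C * (1 + norm z) ^ (2 + 4) * norm (F 1 z)"
      unfolding C_def power_add by (simp only: mult_ac)
    finally show ?thesis using z by (simp add: Y_def)
  qed
  with C show ?thesis by blast
qed

text \<open>
  A constituent \<open>g\<close> of a convex combination extends to an entire function whose growth in the lower half-plane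
  is matched by that of \<open>F 1\<close>, and the ratio of the two is real and bounded on the real line. So \<open>g\<close> is a
  constant multiple of \<open>f 1\<close>, and the norms and the sign leave only the constant \<open>1\<close>.
\<close>

lemma f_Ext: "f 1 \<in> Ext_PW1 S"
proof -
  have fi: "integrable lborel (f 1)" using f_PW1 by (auto simp: PW1_def)
  have False if g: "g \<in> ball_PW1 S" and h: "h \<in> ball_PW1 S" and t: "0 < t" "t < 1"
    and ne: "\<not> eq_ae g h" and mid: "eq_ae (f 1) (\<lambda>x. (1 - t) *\<^sub>R g x + t *\<^sub>R h x)" for g h t
  proof -
    have gP: "g \<in> PW1 S" "norm1 g \<le> 1" and hP: "h \<in> PW1 S" "norm1 h \<le> 1"
      using g h by (auto simp: ball_PW1_def)
    have gi: "integrable lborel g" "integrable lborel h" using gP hP by (auto simp: PW1_def)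
    note cc = convex_combination_norm_eq[OF fi gi norm1_f gP(2) hP(2) t mid]
    have "S \<subseteq> {- (2 * a + d)..2 * a + d}" using d da by (auto simp: S_def)
    then obtain G where G: "G holomorphic_on UNIV" and gG: "eq_ae g (\<lambda>x. G (of_real x))"
      and Gbd: "\<And>z. norm (G z) \<le> 2 * (2 * a + d) * norm1 g * exp (2 * pi * (2 * a + d) * \<bar>Im z\<bar>)"
      using PW1_entire_extension[OF gP(1) closed_S] by metis
    define F1 where "F1 = (\<lambda>z. of_real (1 / N 1) * F 1 z)"
    have F1: "F1 holomorphic_on UNIV" unfolding F1_def by (intro holomorphic_intros F_holomorphic)
    have f_F1: "f 1 x = F1 (of_real x)" for x by (simp add: f_def F1_def)
    have contG: "continuous_on UNIV (\<lambda>x. G (of_real x))" and contF: "continuous_on UNIV (\<lambda>x. F1 (of_real x))"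
      by (intro continuous_on_compose2[OF holomorphic_on_imp_continuous_on[OF G]]
          continuous_on_compose2[OF holomorphic_on_imp_continuous_on[OF F1]] continuous_intros; simp)+
    have ae: "AE x in lborel. G (of_real x) * of_real (norm (F1 (of_real x))) = of_real (norm (G (of_real x))) * F1 (of_real x)"
      "AE x in lborel. (1 - t) * norm (G (of_real x)) \<le> norm (F1 (of_real x))"
      using cc(1) gG unfolding eq_ae_def f_F1 by (eventually_elim, simp)+
    \<comment> \<open>Both sides are continuous, so the relations hold at every point.\<close>
    have par: "G (of_real x) * of_real (norm (F1 (of_real x))) = of_real (norm (G (of_real x))) * F1 (of_real x)" for x :: real
      by (rule continuous_AE_eq_imp_eq[OF _ _ ae(1)]) (intro continuous_intros contG contF)+
    have "AE x in lborel. of_real (max 0 ((1 - t) * norm (G (of_real x)) - norm (F1 (of_real x)))) = (0 :: complex)"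
      using ae(2) by eventually_elim simp
    then have "complex_of_real (max 0 ((1 - t) * norm (G (of_real x)) - norm (F1 (of_real x)))) = 0" for x :: real
      by (rule continuous_AE_eq_imp_eq[rotated 2]) (intro continuous_intros contG contF)+
    then have le: "(1 - t) * norm (G (of_real x)) \<le> norm (F1 (of_real x))" for x :: real
      by (simp add: max_def split: if_splits) (smt (verit))
    have "\<exists>\<kappa>. \<forall>z. G z = \<kappa> * F1 z"
    proof -
      obtain C where C: "C \<ge> 0" "\<And>z. Im z < 0 \<Longrightarrow>
          exp (2 * pi * (2 * a + d) * \<bar>Im z\<bar>) * \<bar>Im z\<bar> ^ 4 \<le> C * (1 + norm z) ^ 6 * norm (F 1 z)"
        using F_lower_half_plane_bound by blast
      define B where "B = 2 * (2 * a + d) * norm1 g"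
      have B: "B \<ge> 0" unfolding B_def using d da norm1_nonneg[of g] by simp
      have lower: "norm (G z) * \<bar>Im z\<bar> ^ 4 \<le> B * C * N 1 * (1 + norm z) ^ (2 + 4) * norm (F1 z)"
        if "Im z < 0" for z
      proof -
        have "norm (G z) * \<bar>Im z\<bar> ^ 4 \<le> B * exp (2 * pi * (2 * a + d) * \<bar>Im z\<bar>) * \<bar>Im z\<bar> ^ 4"
          using Gbd[of z] unfolding B_def by (intro mult_right_mono) auto
        also have "\<dots> = B * (exp (2 * pi * (2 * a + d) * \<bar>Im z\<bar>) * \<bar>Im z\<bar> ^ 4)" by (simp only: mult.assoc)
        also have "\<dots> \<le> B * (C * (1 + norm z) ^ 6 * norm (F 1 z))"
          by (intro mult_left_mono C that B)
        also have "norm (F 1 z) = N 1 * norm (F1 z)"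
          unfolding F1_def norm_mult norm_of_real using N_pos[of 1] by simp
        also have "B * (C * (1 + norm z) ^ 6 * (N 1 * norm (F1 z))) = B * C * N 1 * (1 + norm z) ^ (2 + 4) * norm (F1 z)"
          by simp
        finally show ?thesis .
      qed
      have nz: "F1 z \<noteq> 0" if "Im z \<noteq> 0" for z
        using F_1_nonzero[OF that] N_pos[of 1] by (simp add: F1_def)
      have re: "G (of_real x) * cnj (F1 (of_real x)) \<in> \<real>" for x :: real
      proof (cases "F1 (of_real x) = 0")
        case False
        have "G (of_real x) * cnj (F1 (of_real x)) * of_real (norm (F1 (of_real x)))
            = of_real (norm (G (of_real x))) * (F1 (of_real x) * cnj (F1 (of_real x)))"
          using par[of x] by (simp add: mult_ac)
        also have "\<dots> = of_real (norm (G (of_real x)) * (norm (F1 (of_real x)))\<^sup>2)"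
          by (simp only: complex_norm_square[symmetric] of_real_mult of_real_power)
        finally have "G (of_real x) * cnj (F1 (of_real x)) = of_real (norm (G (of_real x)) * norm (F1 (of_real x)))"
          using False by (simp add: power2_eq_square field_simps)
        then show ?thesis by simp
      qed simp
      have le1: "norm (G (of_real x)) \<le> 1 / (1 - t) * norm (F1 (of_real x))" for x :: real
        using le[of x] t by (simp add: field_simps)
      show ?thesis
        by (rule quotient_constant_if_real_bounded[OF F1 G nz re le1 lower]) simp_all
    qed
    then obtain \<kappa> where \<kappa>: "\<And>z. G z = \<kappa> * F1 z" by blast
    have g_f: "eq_ae g (\<lambda>x. \<kappa> * f 1 x)"
      using gG by (simp add: f_F1 \<kappa>)
    have "norm1 g = norm1 (\<lambda>x. \<kappa> * f 1 x)"
      unfolding norm1_def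
    proof (rule integral_cong_AE)
      show "AE x in lborel. norm (g x) = norm (\<kappa> * f 1 x)"
        using g_f unfolding eq_ae_def by eventually_elim simp
    qed (use gi fi in auto)
    then have n\<kappa>: "norm \<kappa> = 1" using cc(2) by (simp add: norm1_cmult norm1_f)
    obtain x :: real where x: "F1 (of_real x) \<noteq> 0"
    proof -
      have "\<exists>x. F1 (of_real x) \<noteq> 0"
      proof (rule ccontr)
        assume "\<not> ?thesis"
        then have "norm1 (f 1) = 0" by (simp add: norm1_def f_F1)
        then show False by (simp add: norm1_f)
      qed
      with that show ?thesis by blast
    qed
    have "\<kappa> = 1" using par[of x] x n\<kappa> by (simp add: \<kappa> norm_mult)
    have "eq_ae g h"
      using g_f mid unfolding eq_ae_def
    proof eventually_elim
      case (elim x)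
      then have "g x = (1 - t) *\<^sub>R g x + t *\<^sub>R h x" using \<open>\<kappa> = 1\<close> by simp
      then have "t *\<^sub>R g x = t *\<^sub>R h x" by (auto simp: scaleR_left_diff_distrib)
      then show ?case using t by (metis scaleR_cancel_left less_irrefl)
    qed
    with ne show False by simp
  qed
  then show ?thesis
    using f_PW1 norm1_f unfolding Ext_PW1_def ball_PW1_def by fastforce
qed

section \<open>Weights of type zero\<close>

text \<open>
  Up to a constant and the exponential with the top frequency, \<open>F 1\<close> times \<open>1 - 4 d\<^sup>2 x\<^sup>2\<close> is the product
  \<open>(1 - e\<^sup>2) (1 + e)\<^sup>2 (1 + p)\<close>, where \<open>e\<close> and \<open>p\<close> are exponentials with negative frequencies. Expanding it
  gives the constant \<open>1\<close> and seven terms whose frequencies are all negative.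
\<close>

lemma F_1_eq_exp_sum:
  obtains c \<mu> where "\<And>j. j < 7 \<Longrightarrow> \<mu> j \<noteq> (0::real)"
    "\<And>x. norm (exp_sum {..<7::nat} c \<mu> x) = 2 * pi / d * \<bar>1 - 4 * d\<^sup>2 * x\<^sup>2\<bar> * norm (F 1 (of_real x))"
proof
  define ks where "ks = [0, 1, 1, 3, 3, 4, 4 :: nat]"
  define ls where "ls = [1, 0, 1, 0, 1, 0, 1 :: nat]"
  define cs where "cs = [1, 2, 2, - 2, - 2, - 1, - 1 :: complex]"
  define \<mu> where "\<mu> = (\<lambda>j. - 2 * pi * (real (ks ! j) * a + real (ls ! j) * d))"
  show "\<mu> j \<noteq> 0" if "j < 7" for j
  proof -
    have "ks ! j > 0 \<or> ls ! j > 0"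
      using that by (auto simp: ks_def ls_def less_Suc_eq numeral_eq_Suc)
    then have "real (ks ! j) * a + real (ls ! j) * d > 0"
    proof
      assume "ks ! j > 0"
      then show ?thesis using d da by (intro add_pos_nonneg) auto
    next
      assume "ls ! j > 0"
      then show ?thesis using d da by (intro add_nonneg_pos) auto
    qed
    then show ?thesis by (simp add: \<mu>_def)
  qed
  fix x :: real
  define e where "e = inverse (cwave a (of_real x))"
  define p where "p = inverse (cwave d (of_real x))"
  have expo: "exp (\<i> * of_real (\<mu> j) * of_real x) = e ^ (ks ! j) * p ^ (ls ! j)" for j
    unfolding e_def p_def unfolding cwave_minus[symmetric]
    unfolding cwave_def exp_of_nat_mult[symmetric] exp_add[symmetric]
    by (simp add: \<mu>_def algebra_simps)
  have "exp_sum {..<7} ((!) cs) \<mu> x = 1 + p + 2 * e + 2 * (e * p) - 2 * e ^ 3 - 2 * (e ^ 3 * p) - e ^ 4 - e ^ 4 * p"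
    unfolding exp_sum_def expo by (simp add: numeral_eq_Suc ks_def ls_def cs_def)
  also have "\<dots> = (1 - e\<^sup>2) * (1 + e)\<^sup>2 * (1 + p)"
    by (simp add: eval_nat_numeral algebra_simps)
  finally have sum: "exp_sum {..<7} ((!) cs) \<mu> x = (1 - e\<^sup>2) * (1 + e)\<^sup>2 * (1 + p)" .
  have "1 - 4 * of_real d ^ 2 * (of_real x)\<^sup>2 = complex_of_real (1 - 4 * d\<^sup>2 * x\<^sup>2)" by simp
  then have "norm (F 1 (of_real x)) * \<bar>1 - 4 * d\<^sup>2 * x\<^sup>2\<bar>
      = norm (F 1 (of_real x) * (1 - 4 * of_real d ^ 2 * (of_real x)\<^sup>2))"
    by (simp only: norm_mult norm_of_real)
  also have "\<dots> = d / (2 * pi) * norm (exp_sum {..<7} ((!) cs) \<mu> x)"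
    unfolding F_1_product sum e_def[symmetric] p_def[symmetric] using d
    by (simp add: norm_mult norm_divide norm_power cwave_of_real)
  finally show "norm (exp_sum {..<7} ((!) cs) \<mu> x) = 2 * pi / d * \<bar>1 - 4 * d\<^sup>2 * x\<^sup>2\<bar> * norm (F 1 (of_real x))"
    using d by (simp add: field_simps)
qed

text \<open>
  Otherwise \<open>w\<close> is integrable against an exponential sum divided by \<open>1 + x\<^sup>2\<close>, hence affine, and an affine
  function that is nonnegative on the whole line is constant.
\<close>

lemma not_integrable_against_weight:
  assumes hol: "w holomorphic_on UNIV" and nc: "\<not> w constant_on UNIV" and type: "has_exp_type w 0"
    and nonneg: "\<And>x::real. w (of_real x) \<in> \<real>\<^sub>\<ge>\<^sub>0"
  shows "(\<integral>\<^sup>+ x. ennreal (norm (f 1 x) * Re (w (of_real x))) \<partial>lborel) = \<infinity>"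
proof (rule ccontr)
  assume fin: "\<not> ?thesis"
  have wre: "w (of_real x) = of_real (Re (w (of_real x)))" "Re (w (of_real x)) \<ge> 0" for x :: real
    using nonneg[of x] by (auto simp: complex_nonneg_Reals_iff complex_eq_iff)
  have wm[measurable]: "(\<lambda>x. w (of_real x)) \<in> borel_measurable borel"
    by (intro borel_measurable_continuous_onI
        continuous_on_compose2[OF holomorphic_on_imp_continuous_on[OF hol]] continuous_intros) auto
  have "integrable lborel (f 1)" using f_PW1[of 1] by (simp add: PW1_def)
  then have fm[measurable]: "f 1 \<in> borel_measurable borel" by auto
  have int: "integrable lborel (\<lambda>x. norm (f 1 x) * Re (w (of_real x)))"
    using fin wre(2) by (intro integrableI_nonneg) (auto simp: top.not_eq_extremum)
  have w: "of_type_0 w" using hol type by (auto simp: of_type_0_def has_exp_type_def)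
  obtain c \<mu> where \<mu>: "\<And>j. j < 7 \<Longrightarrow> \<mu> j \<noteq> (0::real)"
    and T: "\<And>x. norm (exp_sum {..<7::nat} c \<mu> x) = 2 * pi / d * \<bar>1 - 4 * d\<^sup>2 * x\<^sup>2\<bar> * norm (F 1 (of_real x))"
    by (rule F_1_eq_exp_sum) (rule that)
  define K where "K = 2 * pi / d * (1 + 4 * d\<^sup>2) * N 1"
  have "integrable lborel (\<lambda>x. w (of_real x) * exp_sum {..<7} c \<mu> x / of_real (1 + x\<^sup>2))"
  proof (rule Bochner_Integration.integrable_bound[OF integrable_mult_right[OF int, of K]])
    show "(\<lambda>x. w (of_real x) * exp_sum {..<7} c \<mu> x / of_real (1 + x\<^sup>2)) \<in> borel_measurable lborel"
      unfolding exp_sum_def by measurable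
    show "AE x in lborel. norm (w (of_real x) * exp_sum {..<7} c \<mu> x / of_real (1 + x\<^sup>2))
        \<le> norm (K * (norm (f 1 x) * Re (w (of_real x))))"
    proof (rule AE_I2)
      fix x :: real
      have pos: "1 + x\<^sup>2 > 0" by (simp add: add_pos_nonneg)
      have "\<bar>1 - 4 * d\<^sup>2 * x\<^sup>2\<bar> \<le> 1 + 4 * d\<^sup>2 * x\<^sup>2"
        using abs_triangle_ineq4[of 1 "4 * d\<^sup>2 * x\<^sup>2"] by simp
      also have "\<dots> \<le> (1 + 4 * d\<^sup>2) * (1 + x\<^sup>2)" by (simp add: algebra_simps)
      finally have "norm (exp_sum {..<7} c \<mu> x) \<le> 2 * pi / d * ((1 + 4 * d\<^sup>2) * (1 + x\<^sup>2)) * norm (F 1 (of_real x))"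
        unfolding T using d by (intro mult_right_mono mult_left_mono) auto
      also have "norm (F 1 (of_real x)) = N 1 * norm (f 1 x)"
        unfolding f_def norm_mult norm_of_real using N_pos[of 1] by simp
      finally have le: "norm (exp_sum {..<7} c \<mu> x) / (1 + x\<^sup>2) \<le> K * norm (f 1 x)"
        using pos by (simp add: K_def pos_divide_le_eq mult_ac)
      have "norm (w (of_real x)) = Re (w (of_real x))"
        using wre[of x] by (metis norm_of_real abs_of_nonneg)
      moreover have "norm (complex_of_real (1 + x\<^sup>2)) = 1 + x\<^sup>2"
        unfolding norm_of_real using pos by simp
      ultimately have "norm (w (of_real x) * exp_sum {..<7} c \<mu> x / of_real (1 + x\<^sup>2))
          = Re (w (of_real x)) * (norm (exp_sum {..<7} c \<mu> x) / (1 + x\<^sup>2))"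
        by (simp only: norm_mult norm_divide times_divide_eq_right)
      also have "\<dots> \<le> Re (w (of_real x)) * (K * norm (f 1 x))"
        by (intro mult_left_mono le wre(2))
      also have "\<dots> \<le> norm (K * (norm (f 1 x) * Re (w (of_real x))))" by (simp add: mult_ac)
      finally show "norm (w (of_real x) * exp_sum {..<7} c \<mu> x / of_real (1 + x\<^sup>2))
          \<le> norm (K * (norm (f 1 x) * Re (w (of_real x))))" .
    qed
  qed
  then obtain \<alpha> \<beta> where ab: "\<And>z. w z = \<alpha> + \<beta> * z"
    using affine_if_integrable_against_exp_sum[OF w, of "{..<7}" \<mu> c] \<mu> by auto
  have "Im \<alpha> = 0" using wre(1)[of 0] by (simp add: ab complex_eq_iff)
  then have Im: "Im \<beta> = 0" using wre(1)[of 1] by (simp add: ab complex_eq_iff)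
  have ge: "Re \<alpha> + Re \<beta> * x \<ge> 0" for x using wre(2)[of x] by (simp add: ab)
  have "Re \<beta> = 0"
  proof (rule ccontr)
    assume "Re \<beta> \<noteq> 0"
    then show False using ge[of "- (Re \<alpha> + 1) / Re \<beta>"] by simp
  qed
  with Im have "\<beta> = 0" by (simp add: complex_eq_iff)
  then have "w constant_on UNIV" by (auto simp: constant_on_def ab)
  with nc show False by simp
qed

end

section \<open>The two examples\<close>

theorem theorem4:
  fixes \<rho> \<sigma> :: real and S :: "real set"
  assumes "0 < \<rho>" and "\<rho> < \<sigma> / 2"
    and S: "S = {- \<sigma>..- \<rho>} \<union> {\<rho>..\<sigma>}"
  shows "(\<exists>f\<in>PW1 S. \<exists>fm fp. spectral_parts \<rho> \<sigma> f fm fp \<and>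
            norm1 f = 1 \<and>
            Lambda fm \<inter> Lambda fp = {} \<and>
            (\<sigma> \<in> Sp f \<or> - \<sigma> \<in> Sp f) \<and>
            f \<notin> Ext_PW1 S)
       \<and> (\<exists>f\<in>Ext_PW1 S. \<exists>fm fp. spectral_parts \<rho> \<sigma> f fm fp \<and>
            Omega_points fm \<inter> Omega_points fp = {} \<and>
            (\<sigma> \<in> Sp f \<or> - \<sigma> \<in> Sp f) \<and>
            (\<forall>w. w holomorphic_on UNIV \<and> \<not> w constant_on UNIV \<and> has_exp_type w 0 \<and>
                 (\<forall>x::real. w (of_real x) \<in> \<real>\<^sub>\<ge>\<^sub>0) \<longrightarrow>
                 (\<integral>\<^sup>+ x. ennreal (norm (f x) * Re (w (of_real x))) \<partial>lborel) = \<infinity>) \<and>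
            f \<notin> Exp_PW1 S)"
proof -
  \<comment> \<open>The solution of \<open>a - d = \<rho>\<close>, \<open>2 a + d = \<sigma>\<close>.\<close>
  define a where "a = (\<sigma> + \<rho>) / 3"
  define d where "d = (\<sigma> - 2 * \<rho>) / 3"
  have eqs: "a - d = \<rho>" "2 * a + d = \<sigma>" by (simp_all add: a_def d_def field_simps)
  interpret tb: two_bands a d
    by unfold_locales (use assms in \<open>auto simp: a_def d_def field_simps\<close>)
  have S_eq: "tb.S = S" by (simp only: tb.S_def S eqs)
  note parts = tb.spectral_parts_f[unfolded eqs] and top = tb.top_in_Sp[unfolded eqs]
  have "spectral_parts \<rho> \<sigma> (tb.f 2) (\<lambda>z. of_real (1 / tb.N 2) * tb.Fm 2 z) (\<lambda>z. of_real (1 / tb.N 2) * tb.Fp 2 z) \<and>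
      norm1 (tb.f 2) = 1 \<and>
      Lambda (\<lambda>z. of_real (1 / tb.N 2) * tb.Fm 2 z) \<inter> Lambda (\<lambda>z. of_real (1 / tb.N 2) * tb.Fp 2 z) = {} \<and>
      (\<sigma> \<in> Sp (tb.f 2) \<or> - \<sigma> \<in> Sp (tb.f 2)) \<and> tb.f 2 \<notin> Ext_PW1 S"
    using parts[of 2] tb.norm1_f tb.Lambda_fp[of 2] top[of 2] tb.f_not_Ext[of 2] S_eq by simp
  moreover have "tb.f 2 \<in> PW1 S" using tb.f_PW1[of 2] S_eq by simp
  moreover have "spectral_parts \<rho> \<sigma> (tb.f 1) (\<lambda>z. of_real (1 / tb.N 1) * tb.Fm 1 z) (\<lambda>z. of_real (1 / tb.N 1) * tb.Fp 1 z) \<and>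
      Omega_points (\<lambda>z. of_real (1 / tb.N 1) * tb.Fm 1 z) \<inter> Omega_points (\<lambda>z. of_real (1 / tb.N 1) * tb.Fp 1 z) = {} \<and>
      (\<sigma> \<in> Sp (tb.f 1) \<or> - \<sigma> \<in> Sp (tb.f 1)) \<and>
      (\<forall>w. w holomorphic_on UNIV \<and> \<not> w constant_on UNIV \<and> has_exp_type w 0 \<and>
           (\<forall>x::real. w (of_real x) \<in> \<real>\<^sub>\<ge>\<^sub>0) \<longrightarrow>
           (\<integral>\<^sup>+ x. ennreal (norm (tb.f 1 x) * Re (w (of_real x))) \<partial>lborel) = \<infinity>) \<and>
      tb.f 1 \<notin> Exp_PW1 S"
  proof (intro conjI allI impI)
    show "Omega_points (\<lambda>z. of_real (1 / tb.N 1) * tb.Fm 1 z) \<inter> Omega_points (\<lambda>z. of_real (1 / tb.N 1) * tb.Fp 1 z) = {}"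
      using tb.Omega_points_fp[of 1] by simp
    show "\<sigma> \<in> Sp (tb.f 1) \<or> - \<sigma> \<in> Sp (tb.f 1)" using top by simp
    show "tb.f 1 \<notin> Exp_PW1 S" using tb.f_not_Exp S_eq by simp
    show "spectral_parts \<rho> \<sigma> (tb.f 1) (\<lambda>z. of_real (1 / tb.N 1) * tb.Fm 1 z) (\<lambda>z. of_real (1 / tb.N 1) * tb.Fp 1 z)"
      by (rule parts)
    fix w
    assume "w holomorphic_on UNIV \<and> \<not> w constant_on UNIV \<and> has_exp_type w 0 \<and>
      (\<forall>x::real. w (of_real x) \<in> \<real>\<^sub>\<ge>\<^sub>0)"
    then show "(\<integral>\<^sup>+ x. ennreal (norm (tb.f 1 x) * Re (w (of_real x))) \<partial>lborel) = \<infinity>"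
      by (intro tb.not_integrable_against_weight) auto
  qed
  moreover have "tb.f 1 \<in> Ext_PW1 S" using tb.f_Ext S_eq by simp
  ultimately show ?thesis by blast
qed

end
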